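(* Let $(M,\pi)$ be a Poisson manifold of dimension $n\ge 1$. If there exists an isotropy point $x\in M$ (i.e. $\pi_x=0$) such that the Lie algebra $\mathfrak{g}_x=(T_x^*M,[\cdot,\cdot]_\pi)$ is semisimple, then $(M,\pi)$ is not locally desingularizable at $x$, and hence $(M,\pi)$ is not (globally) desingularizable.
   Context: Manifolds are smooth, connected and without boundary. A Lie algebroid over $U$ is a smooth vector bundle $\mathcal{A}\to U$ (of constant rank) with a Lie bracket on $\Gamma(\mathcal{A})$ and a bundle map $\rho:\mathcal{A}\to TU$ (the anchor) satisfying the Leibniz rule. It is almost-injective if $\rho_p$ is injective for all $p$ in some open dense subset of $U$. A symplectic Lie algebroid $(\mathcal{A},\rho,\pi_{\mathcal{A}})$ is a Lie algebroid with a nondegenerate section $\pi_{\mathcal{A}}\in\Gamma(\bigwedge^2\mathcal{A})$ (i.e. $\pi_{\mathcal{A}}^\sharp:\mathcal{A}^*\to\mathcal{A}$ is an isomorphism) with $[\pi_{\mathcal{A}},\pi_{\mathcal{A}}]=0$ for the Schouten-Nijenhuis bracket. Rank $0$ is allowed. $(M,\pi)$ is locally desingularizable at $x$ if there exist an open set $U\ni x$ and a symplectic Lie algebroid $(\mathcal{A},\rho,\pi_{\mathcal{A}})$ over $U$ with almost-injective anchor such that $\wedge^2\rho(\pi_{\mathcal{A}})=\pi|_U$. It is desingularizable if this holds with $U=M$. At an isotropy point $x$, the space $T_x^*M$ is a Lie algebra, denoted $\mathfrak{g}_x$, with bracket $[d_xf,d_xg]_\pi=d_x\{f,g\}$, where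 $\{f,g\}=\pi(df,dg)$. *)

theory Defs
  imports "HOL-Analysis.Analysis" "HOL-Library.Function_Algebras"
begin

text \<open>Functions into a real vector space form a real vector space pointwise, so that sections,
  tangent vectors (operators on functions), covectors and multivectors all live in types of class
  \<^class>\<open>real_vector\<close>, and \<^const>\<open>subspace\<close>, \<^const>\<open>span\<close> and finite sums apply to them.\<close>

instantiation "fun" :: (type, real_vector) real_vector
begin

definition scaleR_fun :: "real \<Rightarrow> ('a \<Rightarrow> 'b) \<Rightarrow> 'a \<Rightarrow> 'b"
  where "scaleR_fun c f = (\<lambda>x. c *\<^sub>R f x)"

instance
  by standard (simp_all add: scaleR_fun_def plus_fun_def fun_eq_iff algebra_simps)

end

subsection \<open>Multilinear algebra on a subspace of a real vector space\<close>

text \<open>Covectors and multivectors are extended by \<open>0\<close> outside their domain, so that equality of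
  functions is equality of forms.\<close>

definition linear_form_on :: "'v::real_vector set \<Rightarrow> ('v \<Rightarrow> real) \<Rightarrow> bool"
  where "linear_form_on V \<alpha> \<longleftrightarrow>
    (\<forall>u\<in>V. \<forall>v\<in>V. \<alpha> (u + v) = \<alpha> u + \<alpha> v) \<and> (\<forall>c. \<forall>v\<in>V. \<alpha> (c *\<^sub>R v) = c * \<alpha> v)"

definition dual_space :: "'v::real_vector set \<Rightarrow> ('v \<Rightarrow> real) set"
  where "dual_space V = {\<alpha>. linear_form_on V \<alpha> \<and> (\<forall>v. v \<notin> V \<longrightarrow> \<alpha> v = 0)}"

text \<open>For finite-dimensional \<open>V\<close>, elements of \<open>\<Lambda>\<^sup>k V\<close> are represented as alternating \<open>k\<close>-linear forms
  on the dual of \<open>V\<close>, with the determinant convention for decomposable elements.\<close>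

type_synonym 'v bivector = "('v \<Rightarrow> real) \<Rightarrow> ('v \<Rightarrow> real) \<Rightarrow> real"
type_synonym 'v trivector = "('v \<Rightarrow> real) \<Rightarrow> ('v \<Rightarrow> real) \<Rightarrow> ('v \<Rightarrow> real) \<Rightarrow> real"

definition wedge2 :: "'v::real_vector set \<Rightarrow> 'v \<Rightarrow> 'v \<Rightarrow> 'v bivector"
  where "wedge2 V u v = (\<lambda>\<alpha> \<beta>.
    if \<alpha> \<in> dual_space V \<and> \<beta> \<in> dual_space V then \<alpha> u * \<beta> v - \<alpha> v * \<beta> u else 0)"

definition wedge3 :: "'v::real_vector set \<Rightarrow> 'v \<Rightarrow> 'v \<Rightarrow> 'v \<Rightarrow> 'v trivector"
  where "wedge3 V u v w = (\<lambda>\<alpha> \<beta> \<gamma>.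
    if \<alpha> \<in> dual_space V \<and> \<beta> \<in> dual_space V \<and> \<gamma> \<in> dual_space V
    then \<alpha> u * (\<beta> v * \<gamma> w - \<beta> w * \<gamma> v)
       - \<alpha> v * (\<beta> u * \<gamma> w - \<beta> w * \<gamma> u)
       + \<alpha> w * (\<beta> u * \<gamma> v - \<beta> v * \<gamma> u)
    else 0)"

text \<open>The map \<open>V\<^sup>* \<rightarrow> V\<close> sending \<open>\<alpha>\<close> to \<open>P(\<alpha>, \<cdot>)\<close>, an element of the bidual, identified with \<open>V\<close>.\<close>

definition sharp :: "'v::real_vector set \<Rightarrow> 'v bivector \<Rightarrow> ('v \<Rightarrow> real) \<Rightarrow> 'v"
  where "sharp V P \<alpha> = (THE v. v \<in> V \<and> (\<forall>\<beta>\<in>dual_space V. \<beta> v = P \<alpha> \<beta>))"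

definition nondegenerate :: "'v::real_vector set \<Rightarrow> 'v bivector \<Rightarrow> bool"
  where "nondegenerate V P \<longleftrightarrow> bij_betw (sharp V P) (dual_space V) V"

definition pullback_form ::
    "'v::real_vector set \<Rightarrow> ('v \<Rightarrow> 'w) \<Rightarrow> ('w::real_vector \<Rightarrow> real) \<Rightarrow> 'v \<Rightarrow> real"
  where "pullback_form V \<rho> \<alpha> = (\<lambda>v. if v \<in> V then \<alpha> (\<rho> v) else 0)"

text \<open>\<open>\<Lambda>\<^sup>2\<rho> : \<Lambda>\<^sup>2V \<rightarrow> \<Lambda>\<^sup>2W\<close> for a linear \<open>\<rho> : V \<rightarrow> W\<close>.\<close>

definition wedge2_map ::
    "'v::real_vector set \<Rightarrow> 'w::real_vector set \<Rightarrow> ('v \<Rightarrow> 'w) \<Rightarrow> 'v bivector \<Rightarrow> 'w bivector"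
  where "wedge2_map V W \<rho> P = (\<lambda>\<alpha> \<beta>.
    if \<alpha> \<in> dual_space W \<and> \<beta> \<in> dual_space W
    then P (pullback_form V \<rho> \<alpha>) (pullback_form V \<rho> \<beta>) else 0)"

subsection \<open>Lie algebras\<close>

definition lie_algebra :: "'a::real_vector set \<Rightarrow> ('a \<Rightarrow> 'a \<Rightarrow> 'a) \<Rightarrow> bool"
  where "lie_algebra L br \<longleftrightarrow> subspace L \<and>
    (\<forall>x\<in>L. \<forall>y\<in>L. br x y \<in> L) \<and>
    (\<forall>x\<in>L. \<forall>y\<in>L. \<forall>z\<in>L. br (x + y) z = br x z + br y z \<and> br z (x + y) = br z x + br z y) \<and>
    (\<forall>c. \<forall>x\<in>L. \<forall>y\<in>L. br (c *\<^sub>R x) y = c *\<^sub>R br x y \<and> br x (c *\<^sub>R y) = c *\<^sub>R br x y) \<and>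
    (\<forall>x\<in>L. br x x = 0) \<and>
    (\<forall>x\<in>L. \<forall>y\<in>L. \<forall>z\<in>L. br x (br y z) + br y (br z x) + br z (br x y) = 0)"

definition lie_ideal :: "'a::real_vector set \<Rightarrow> ('a \<Rightarrow> 'a \<Rightarrow> 'a) \<Rightarrow> 'a set \<Rightarrow> bool"
  where "lie_ideal L br I \<longleftrightarrow> subspace I \<and> I \<subseteq> L \<and> (\<forall>x\<in>L. \<forall>y\<in>I. br x y \<in> I)"

definition derived_subalgebra :: "('a::real_vector \<Rightarrow> 'a \<Rightarrow> 'a) \<Rightarrow> 'a set \<Rightarrow> 'a set"
  where "derived_subalgebra br I = span {br x y | x y. x \<in> I \<and> y \<in> I}"

definition lie_solvable :: "('a::real_vector \<Rightarrow> 'a \<Rightarrow> 'a) \<Rightarrow> 'a set \<Rightarrow> bool"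
  where "lie_solvable br I \<longleftrightarrow> (\<exists>k. (derived_subalgebra br ^^ k) I = {0})"

definition semisimple_lie_algebra :: "'a::real_vector set \<Rightarrow> ('a \<Rightarrow> 'a \<Rightarrow> 'a) \<Rightarrow> bool"
  where "semisimple_lie_algebra L br \<longleftrightarrow>
    lie_algebra L br \<and> (\<forall>I. lie_ideal L br I \<and> lie_solvable br I \<longrightarrow> I = {0})"

subsection \<open>Smooth manifolds\<close>

text \<open>\<open>C\<^sup>k\<close> and smooth maps on an open subset of a Euclidean space.\<close>

primrec Ck_on :: "nat \<Rightarrow> 'e::euclidean_space set \<Rightarrow> ('e \<Rightarrow> 'b::real_normed_vector) \<Rightarrow> bool"
  where
    "Ck_on 0 S f = continuous_on S f"
  | "Ck_on (Suc k) S f = ((\<forall>x\<in>S. f differentiable (at x)) \<and>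
      (\<forall>w. Ck_on k S (\<lambda>x. frechet_derivative f (at x) w)))"

definition smooth_on :: "'e::euclidean_space set \<Rightarrow> ('e \<Rightarrow> 'b::real_normed_vector) \<Rightarrow> bool"
  where "smooth_on S f \<longleftrightarrow> (\<forall>k. Ck_on k S f)"

text \<open>A manifold has point set \<open>topspace (topo M)\<close>. A chart is a pair of an open domain and a
  coordinate map with values in the model space \<open>'e\<close>; the dimension \<open>DIM('e)\<close> is always positive.\<close>

record ('m, 'e) smooth_manifold =
  topo :: "'m topology"
  atlas :: "('m set \<times> ('m \<Rightarrow> 'e)) set"

definition points :: "('m, 'e) smooth_manifold \<Rightarrow> 'm set"
  where "points M = topspace (topo M)"

definition chart_in :: "'m topology \<Rightarrow> 'm set \<times> ('m \<Rightarrow> 'e::euclidean_space) \<Rightarrow> bool"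
  where "chart_in X = (\<lambda>(W, \<phi>). openin X W \<and> open (\<phi> ` W) \<and>
    homeomorphic_map (subtopology X W) (top_of_set (\<phi> ` W)) \<phi>)"

definition smooth_manifold :: "('m, 'e::euclidean_space) smooth_manifold \<Rightarrow> bool"
  where "smooth_manifold M \<longleftrightarrow>
    Hausdorff_space (topo M) \<and> second_countable (topo M) \<and> connected_space (topo M) \<and>
    (\<forall>c\<in>atlas M. chart_in (topo M) c) \<and>
    (\<Union>c\<in>atlas M. fst c) = points M \<and>
    (\<forall>(W, \<phi>)\<in>atlas M. \<forall>(W', \<psi>)\<in>atlas M. smooth_on (\<phi> ` (W \<inter> W')) (\<psi> \<circ> inv_into W \<phi>))"

definition smooth_fun ::
    "('m, 'e::euclidean_space) smooth_manifold \<Rightarrow> 'm set \<Rightarrow> ('m \<Rightarrow> real) \<Rightarrow> bool"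
  where "smooth_fun M S f \<longleftrightarrow>
    (\<forall>(W, \<phi>)\<in>atlas M. smooth_on (\<phi> ` (W \<inter> S)) (f \<circ> inv_into W \<phi>))"

definition smooth_at :: "('m, 'e::euclidean_space) smooth_manifold \<Rightarrow> 'm \<Rightarrow> ('m \<Rightarrow> real) \<Rightarrow> bool"
  where "smooth_at M p f \<longleftrightarrow> (\<exists>S. openin (topo M) S \<and> p \<in> S \<and> smooth_fun M S f)"

text \<open>The tangent vector at \<open>p\<close> with components \<open>w\<close> in a chart, identified with the
  directional derivative it defines on functions that are smooth near \<open>p\<close> (and with \<open>0\<close> on the other
  functions). By the chain rule two pairs (chart, \<open>w\<close>) give the same operator iff they are related by
  the derivative of the transition map. For an open \<open>U\<close> the tangent spaces of \<open>U\<close> and of \<open>M\<close>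
  at \<open>p \<in> U\<close> coincide.\<close>

definition chart_vector ::
    "('m, 'e::euclidean_space) smooth_manifold \<Rightarrow> 'm set \<times> ('m \<Rightarrow> 'e) \<Rightarrow> 'm \<Rightarrow> 'e
      \<Rightarrow> ('m \<Rightarrow> real) \<Rightarrow> real"
  where "chart_vector M c p w = (\<lambda>f. if smooth_at M p f
    then frechet_derivative (f \<circ> inv_into (fst c) (snd c)) (at (snd c p)) w else 0)"

definition tangent_space ::
    "('m, 'e::euclidean_space) smooth_manifold \<Rightarrow> 'm \<Rightarrow> (('m \<Rightarrow> real) \<Rightarrow> real) set"
  where "tangent_space M p = {chart_vector M c p w | c w. c \<in> atlas M \<and> p \<in> fst c}"

definition cotangent_space ::
    "('m, 'e::euclidean_space) smooth_manifold \<Rightarrow> 'm \<Rightarrow> ((('m \<Rightarrow> real) \<Rightarrow> real) \<Rightarrow> real) set"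
  where "cotangent_space M p = dual_space (tangent_space M p)"

definition differential ::
    "('m, 'e::euclidean_space) smooth_manifold \<Rightarrow> 'm \<Rightarrow> ('m \<Rightarrow> real)
      \<Rightarrow> (('m \<Rightarrow> real) \<Rightarrow> real) \<Rightarrow> real"
  where "differential M p f = (\<lambda>v. if v \<in> tangent_space M p then v f else 0)"

subsection \<open>Vector bundles\<close>

text \<open>The fibres are subspaces of a real vector space \<open>'v\<close>. Only the linear structure of \<open>'v\<close> is used:
  nothing relates fibres over different points except the smooth structure, which is given by an
  atlas of local trivialisations. A trivialisation over \<open>W\<close> is recorded as the local frame
  \<open>e 0, \<dots>, e (r - 1)\<close> that it maps to the standard basis of \<open>\<real>\<^sup>r\<close>. Up to a choice
  of basis in every fibre (no continuity needed), every vector bundle has this form.\<close>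

record ('m, 'v) vector_bundle =
  fibre :: "'m \<Rightarrow> 'v set"
  vb_rank :: nat
  frames :: "('m set \<times> (nat \<Rightarrow> 'm \<Rightarrow> 'v)) set"

definition basis_family :: "'v::real_vector set \<Rightarrow> nat \<Rightarrow> (nat \<Rightarrow> 'v) \<Rightarrow> bool"
  where "basis_family V r b \<longleftrightarrow>
    inj_on b {..<r} \<and> independent (b ` {..<r}) \<and> span (b ` {..<r}) = V"

definition smooth_section ::
    "('m, 'e::euclidean_space) smooth_manifold \<Rightarrow> ('m, 'v::real_vector, 'z) vector_bundle_scheme
      \<Rightarrow> 'm set \<Rightarrow> ('m \<Rightarrow> 'v) \<Rightarrow> bool"
  where "smooth_section M E S s \<longleftrightarrow> (\<forall>p\<in>S. s p \<in> fibre E p) \<and>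
    (\<forall>(W, e)\<in>frames E. \<exists>c. (\<forall>i<vb_rank E. smooth_fun M (W \<inter> S) (c i)) \<and>
      (\<forall>p\<in>W \<inter> S. s p = (\<Sum>i<vb_rank E. c i p *\<^sub>R e i p)))"

text \<open>The second condition says that the transition matrices between frames are smooth.\<close>

definition vector_bundle ::
    "('m, 'e::euclidean_space) smooth_manifold \<Rightarrow> 'm set
      \<Rightarrow> ('m, 'v::real_vector, 'z) vector_bundle_scheme \<Rightarrow> bool"
  where "vector_bundle M U E \<longleftrightarrow> openin (topo M) U \<and>
    (\<forall>(W, e)\<in>frames E. openin (topo M) W \<and> W \<subseteq> U \<and>
      (\<forall>p\<in>W. basis_family (fibre E p) (vb_rank E) (\<lambda>i. e i p))) \<and>
    (\<forall>(W, e)\<in>frames E. \<forall>i<vb_rank E. smooth_section M E W (e i)) \<and>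
    (\<Union>c\<in>frames E. fst c) = U"

text \<open>\<open>\<Gamma>(E)\<close> for a bundle over \<open>U\<close>; the values outside \<open>U\<close> are normalised to \<open>0\<close>.\<close>

definition sections ::
    "('m, 'e::euclidean_space) smooth_manifold \<Rightarrow> 'm set
      \<Rightarrow> ('m, 'v::real_vector, 'z) vector_bundle_scheme \<Rightarrow> ('m \<Rightarrow> 'v) set"
  where "sections M U E = {s. smooth_section M E U s \<and> (\<forall>p. p \<notin> U \<longrightarrow> s p = 0)}"

text \<open>Smooth sections of \<open>\<Lambda>\<^sup>2E\<close>, in the frames \<open>e\<^sub>i \<and> e\<^sub>j\<close> with \<open>i < j\<close>.\<close>

definition bivector_field ::
    "('m, 'e::euclidean_space) smooth_manifold \<Rightarrow> 'm set
      \<Rightarrow> ('m, 'v::real_vector, 'z) vector_bundle_scheme \<Rightarrow> ('m \<Rightarrow> 'v bivector) \<Rightarrow> bool"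
  where "bivector_field M U E P \<longleftrightarrow>
    (\<forall>(W, e)\<in>frames E. \<exists>c. (\<forall>i j. smooth_fun M (W \<inter> U) (c i j)) \<and>
      (\<forall>p\<in>W \<inter> U. P p =
        (\<Sum>j<vb_rank E. \<Sum>i<j. c i j p *\<^sub>R wedge2 (fibre E p) (e i p) (e j p))))"

text \<open>Every chart and every enumeration of the standard basis give a coordinate frame.\<close>

definition tangent_bundle ::
    "('m, 'e::euclidean_space) smooth_manifold \<Rightarrow> ('m, ('m \<Rightarrow> real) \<Rightarrow> real) vector_bundle"
  where "tangent_bundle M =
    \<lparr>fibre = tangent_space M, vb_rank = DIM('e),
     frames = {(W, \<lambda>i p. chart_vector M (W, \<phi>) p (b i)) | W \<phi> b.
       (W, \<phi>) \<in> atlas M \<and> bij_betw b {..<DIM('e)} Basis}\<rparr>"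

subsection \<open>Poisson manifolds\<close>

type_synonym 'm tangent_bivector_field = "'m \<Rightarrow> (('m \<Rightarrow> real) \<Rightarrow> real) bivector"

definition poisson_bracket ::
    "('m, 'e::euclidean_space) smooth_manifold \<Rightarrow> 'm tangent_bivector_field
      \<Rightarrow> ('m \<Rightarrow> real) \<Rightarrow> ('m \<Rightarrow> real) \<Rightarrow> 'm \<Rightarrow> real"
  where "poisson_bracket M \<pi> f g = (\<lambda>p. \<pi> p (differential M p f) (differential M p g))"

definition poisson_manifold ::
    "('m, 'e::euclidean_space) smooth_manifold \<Rightarrow> 'm tangent_bivector_field \<Rightarrow> bool"
  where "poisson_manifold M \<pi> \<longleftrightarrow> smooth_manifold M \<and>
    bivector_field M (points M) (tangent_bundle M) \<pi> \<and>
    (\<forall>f g h. smooth_fun M (points M) f \<and> smooth_fun M (points M) g \<and> smooth_fun M (points M) h \<longrightarrow>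
      (\<forall>p\<in>points M. poisson_bracket M \<pi> f (poisson_bracket M \<pi> g h) p
        + poisson_bracket M \<pi> g (poisson_bracket M \<pi> h f) p
        + poisson_bracket M \<pi> h (poisson_bracket M \<pi> f g) p = 0))"

definition isotropy_point ::
    "('m, 'e::euclidean_space) smooth_manifold \<Rightarrow> 'm tangent_bivector_field \<Rightarrow> 'm \<Rightarrow> bool"
  where "isotropy_point M \<pi> x \<longleftrightarrow> x \<in> points M \<and> \<pi> x = 0"

text \<open>The bracket on \<open>T\<^sub>x\<^sup>*M\<close> at an isotropy point, \<open>[d\<^sub>xf, d\<^sub>xg] = d\<^sub>x{f, g}\<close>; there the right-hand
  side depends only on \<open>d\<^sub>xf\<close> and \<open>d\<^sub>xg\<close>.\<close>

definition isotropy_bracket ::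
    "('m, 'e::euclidean_space) smooth_manifold \<Rightarrow> 'm tangent_bivector_field \<Rightarrow> 'm
      \<Rightarrow> ((('m \<Rightarrow> real) \<Rightarrow> real) \<Rightarrow> real) \<Rightarrow> ((('m \<Rightarrow> real) \<Rightarrow> real) \<Rightarrow> real)
      \<Rightarrow> (('m \<Rightarrow> real) \<Rightarrow> real) \<Rightarrow> real"
  where "isotropy_bracket M \<pi> x \<alpha> \<beta> = (THE \<gamma>. \<exists>f g.
    smooth_fun M (points M) f \<and> smooth_fun M (points M) g \<and>
    differential M x f = \<alpha> \<and> differential M x g = \<beta> \<and>
    \<gamma> = differential M x (poisson_bracket M \<pi> f g))"

subsection \<open>Lie algebroids\<close>

record ('m, 'v) lie_algebroid = "('m, 'v) vector_bundle" +
  anchor :: "'m \<Rightarrow> 'v \<Rightarrow> ('m \<Rightarrow> real) \<Rightarrow> real"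
  bracket :: "('m \<Rightarrow> 'v) \<Rightarrow> ('m \<Rightarrow> 'v) \<Rightarrow> 'm \<Rightarrow> 'v"

definition bundle_map_to_tangent ::
    "('m, 'e::euclidean_space) smooth_manifold \<Rightarrow> 'm set
      \<Rightarrow> ('m, 'v::real_vector, 'z) vector_bundle_scheme
      \<Rightarrow> ('m \<Rightarrow> 'v \<Rightarrow> ('m \<Rightarrow> real) \<Rightarrow> real) \<Rightarrow> bool"
  where "bundle_map_to_tangent M U E \<rho> \<longleftrightarrow>
    (\<forall>p\<in>U. \<rho> p ` fibre E p \<subseteq> tangent_space M p \<and>
      (\<forall>u\<in>fibre E p. \<forall>v\<in>fibre E p. \<rho> p (u + v) = \<rho> p u + \<rho> p v) \<and>
      (\<forall>c. \<forall>v\<in>fibre E p. \<rho> p (c *\<^sub>R v) = c *\<^sub>R \<rho> p v)) \<and>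
    (\<forall>(W, e)\<in>frames E. \<forall>i<vb_rank E.
      smooth_section M (tangent_bundle M) W (\<lambda>p. \<rho> p (e i p)))"

text \<open>In the Leibniz rule the anchored vector field acts on \<open>f\<close> by \<open>(\<rho>(s) f)(p) = \<rho>\<^sub>p(s(p)) f\<close>.\<close>

definition lie_algebroid ::
    "('m, 'e::euclidean_space) smooth_manifold \<Rightarrow> 'm set
      \<Rightarrow> ('m, 'v::real_vector) lie_algebroid \<Rightarrow> bool"
  where "lie_algebroid M U A \<longleftrightarrow> vector_bundle M U A \<and>
    bundle_map_to_tangent M U A (anchor A) \<and>
    lie_algebra (sections M U A) (bracket A) \<and>
    (\<forall>s\<in>sections M U A. \<forall>t\<in>sections M U A. \<forall>f. smooth_fun M U f \<longrightarrow>
      bracket A s (\<lambda>p. f p *\<^sub>R t p) =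
        (\<lambda>p. f p *\<^sub>R bracket A s t p + anchor A p (s p) f *\<^sub>R t p))"

definition almost_injective ::
    "('m, 'e::euclidean_space) smooth_manifold \<Rightarrow> 'm set
      \<Rightarrow> ('m, 'v::real_vector) lie_algebroid \<Rightarrow> bool"
  where "almost_injective M U A \<longleftrightarrow>
    (\<exists>D. openin (topo M) D \<and> D \<subseteq> U \<and> U \<subseteq> topo M closure_of D \<and>
      (\<forall>p\<in>D. inj_on (anchor A p) (fibre A p)))"

text \<open>\<open>T\<close> is the Schouten--Nijenhuis bracket \<open>[P, Q]\<close> of bivector fields: the \<open>\<real>\<close>-bilinear local
  operation determined by
  \<open>[X\<^sub>1 \<and> X\<^sub>2, Y\<^sub>1 \<and> Y\<^sub>2] = \<Sum>\<^sub>i\<^sub>,\<^sub>j (-1)\<^sup>i\<^sup>+\<^sup>j [X\<^sub>i, Y\<^sub>j] \<and> X\<^sub>i\<^sub>' \<and> Y\<^sub>j\<^sub>'\<close> with \<open>{i, i'} = {j, j'} = {1, 2}\<close>.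
  Near every point of \<open>U\<close> bivector fields are finite sums of wedge products of elements of \<open>\<Gamma>(A)\<close>
  (multiply a local frame by a bump function), so \<open>T\<close> is uniquely determined on \<open>U\<close>.\<close>

definition schouten_decomposable ::
    "('m, 'v::real_vector) lie_algebroid \<Rightarrow> ('m \<Rightarrow> 'v) \<Rightarrow> ('m \<Rightarrow> 'v) \<Rightarrow> ('m \<Rightarrow> 'v) \<Rightarrow> ('m \<Rightarrow> 'v)
      \<Rightarrow> 'm \<Rightarrow> 'v trivector"
  where "schouten_decomposable A X\<^sub>1 X\<^sub>2 Y\<^sub>1 Y\<^sub>2 p =
      wedge3 (fibre A p) (bracket A X\<^sub>1 Y\<^sub>1 p) (X\<^sub>2 p) (Y\<^sub>2 p)
    - wedge3 (fibre A p) (bracket A X\<^sub>1 Y\<^sub>2 p) (X\<^sub>2 p) (Y\<^sub>1 p)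
    - wedge3 (fibre A p) (bracket A X\<^sub>2 Y\<^sub>1 p) (X\<^sub>1 p) (Y\<^sub>2 p)
    + wedge3 (fibre A p) (bracket A X\<^sub>2 Y\<^sub>2 p) (X\<^sub>1 p) (Y\<^sub>1 p)"

definition wedge_decomposition ::
    "('m, 'e::euclidean_space) smooth_manifold \<Rightarrow> 'm set \<Rightarrow> ('m, 'v::real_vector) lie_algebroid
      \<Rightarrow> 'm set \<Rightarrow> ('m \<Rightarrow> 'v bivector) \<Rightarrow> nat \<Rightarrow> (nat \<Rightarrow> 'm \<Rightarrow> 'v) \<Rightarrow> (nat \<Rightarrow> 'm \<Rightarrow> 'v) \<Rightarrow> bool"
  where "wedge_decomposition M U A W P m X Y \<longleftrightarrow>
    (\<forall>k<m. X k \<in> sections M U A \<and> Y k \<in> sections M U A) \<and>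
    (\<forall>q\<in>W. P q = (\<Sum>k<m. wedge2 (fibre A q) (X k q) (Y k q)))"

definition is_schouten_bracket ::
    "('m, 'e::euclidean_space) smooth_manifold \<Rightarrow> 'm set \<Rightarrow> ('m, 'v::real_vector) lie_algebroid
      \<Rightarrow> ('m \<Rightarrow> 'v bivector) \<Rightarrow> ('m \<Rightarrow> 'v bivector) \<Rightarrow> ('m \<Rightarrow> 'v trivector) \<Rightarrow> bool"
  where "is_schouten_bracket M U A P Q T \<longleftrightarrow>
    (\<forall>W m X X' n Y Y'. openin (topo M) W \<and> W \<subseteq> U \<and>
      wedge_decomposition M U A W P m X X' \<and> wedge_decomposition M U A W Q n Y Y' \<longrightarrow>
      (\<forall>p\<in>W. T p = (\<Sum>k<m. \<Sum>l<n. schouten_decomposable A (X k) (X' k) (Y l) (Y' l) p)))"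

definition symplectic_lie_algebroid ::
    "('m, 'e::euclidean_space) smooth_manifold \<Rightarrow> 'm set \<Rightarrow> ('m, 'v::real_vector) lie_algebroid
      \<Rightarrow> ('m \<Rightarrow> 'v bivector) \<Rightarrow> bool"
  where "symplectic_lie_algebroid M U A P \<longleftrightarrow> lie_algebroid M U A \<and>
    bivector_field M U A P \<and>
    (\<forall>p\<in>U. nondegenerate (fibre A p) (P p)) \<and>
    is_schouten_bracket M U A P P (\<lambda>_. 0)"

subsection \<open>Desingularizability\<close>

text \<open>HOL cannot quantify over types inside a formula, so the real vector space type \<open>'v\<close> that
  contains the fibres of the algebroid is a type parameter. A statement that denies
  desingularizability for a free \<open>'v\<close> denies it for algebroids with fibres in any type.\<close>

definition has_desingularization_over ::
    "'v::real_vector itself \<Rightarrow> ('m, 'e::euclidean_space) smooth_manifold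
      \<Rightarrow> 'm tangent_bivector_field \<Rightarrow> 'm set \<Rightarrow> bool"
  where "has_desingularization_over T M \<pi> U \<longleftrightarrow>
    (\<exists>(A :: ('m, 'v) lie_algebroid) P. symplectic_lie_algebroid M U A P \<and>
      almost_injective M U A \<and>
      (\<forall>p\<in>U. wedge2_map (fibre A p) (tangent_space M p) (anchor A p) (P p) = \<pi> p))"

definition locally_desingularizable_at ::
    "'v::real_vector itself \<Rightarrow> ('m, 'e::euclidean_space) smooth_manifold
      \<Rightarrow> 'm tangent_bivector_field \<Rightarrow> 'm \<Rightarrow> bool"
  where "locally_desingularizable_at T M \<pi> x \<longleftrightarrow>
    (\<exists>U. openin (topo M) U \<and> x \<in> U \<and> has_desingularization_over T M \<pi> U)"

definition desingularizable ::
    "'v::real_vector itself \<Rightarrow> ('m, 'e::euclidean_space) smooth_manifold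
      \<Rightarrow> 'm tangent_bivector_field \<Rightarrow> bool"
  where "desingularizable T M \<pi> \<longleftrightarrow> has_desingularization_over T M \<pi> (points M)"

end

theory Submission
  imports Defs
begin

text \<open>
Suppose that a symplectic Lie algebroid \<open>A\<close> with anchor \<open>\<rho>\<close> and bivector \<open>P\<close> desingularizes \<open>\<pi>\<close> near
the isotropy point \<open>x\<close>. The proof studies the subspace \<open>I = {\<alpha> \<in> T\<^sub>x\<^sup>*M. \<alpha> \<circ> \<rho>\<^sub>x = 0}\<close> of the isotropy
Lie algebra. In a local frame \<open>e\<^sub>i\<close> of \<open>A\<close>, with \<open>\<rho>\<^sub>i = \<rho>(e\<^sub>i)\<close> and \<open>P\<^sub>i\<^sub>j\<close> the
coefficients of \<open>P\<close>,
\<open>{f, g} = \<Sum>\<^sub>i\<^sub><\<^sub>j P\<^sub>i\<^sub>j (\<rho>\<^sub>i f \<rho>\<^sub>j g - \<rho>\<^sub>j f \<rho>\<^sub>i g)\<close>.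

If \<open>d\<^sub>xf\<close> and \<open>d\<^sub>xg\<close> are in \<open>I\<close>, every summand is a product of two functions that vanish at \<open>x\<close>, so
\<open>d\<^sub>x{f, g} = 0\<close>: the subspace \<open>I\<close> is abelian (\<open>anchor_annihilator_abelian\<close>). If only \<open>d\<^sub>xg\<close> is in \<open>I\<close>,
then differentiating along \<open>\<rho>\<^sub>k\<close> at \<open>x\<close> leaves second derivatives \<open>\<rho>\<^sub>k \<rho>\<^sub>j g\<close> of \<open>g\<close>. The anchor preserves
brackets and \<open>d\<^sub>xg\<close> kills its image, so these equal \<open>\<rho>\<^sub>j \<rho>\<^sub>k g\<close> at \<open>x\<close>, and the sum becomes
\<open>{f, \<rho>\<^sub>k g}(x)\<close>, which is \<open>0\<close> because \<open>\<pi>\<^sub>x = 0\<close>. So \<open>I\<close> is an ideal (\<open>anchor_annihilator_ideal\<close>).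

A semisimple Lie algebra has no nonzero abelian ideal. Hence \<open>I = 0\<close>, which means that \<open>\<rho>\<^sub>x\<close> is onto
(\<open>semisimple_imp_anchor_surjective\<close>). Almost-injectivity bounds the rank of \<open>A\<close> by \<open>dim M\<close>, so \<open>\<rho>\<^sub>x\<close> is
an isomorphism. It carries \<open>P\<^sub>x\<close> to \<open>\<pi>\<^sub>x = 0\<close>, so \<open>P\<^sub>x = 0\<close>; this contradicts nondegeneracy, since
\<open>dim M > 0\<close> (\<open>surjective_anchor_imp_degenerate\<close>).

The analytic input is the existence of smooth cutoff functions. They provide global functions with
prescribed differential at \<open>x\<close>, which the bracket of \<open>T\<^sub>x\<^sup>*M\<close> refers to, and global sections of \<open>A\<close> that
agree with a local frame near \<open>x\<close>, to which the Jacobi identity and the Leibniz rule apply.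
\<close>

section \<open>Calculus of smooth functions\<close>

lemma Ck_on_subset: "Ck_on k S f \<Longrightarrow> T \<subseteq> S \<Longrightarrow> Ck_on k T f"
proof (induction k arbitrary: f)
  case 0
  then show ?case by (auto intro: continuous_on_subset)
next
  case (Suc k)
  then show ?case by auto
qed

lemma Ck_on_cong:
  assumes "open S" "\<And>y. y \<in> S \<Longrightarrow> f y = g y" "Ck_on k S f"
  shows "Ck_on k S g"
  using assms(2,3)
proof (induction k arbitrary: f g)
  case 0
  then show ?case by (auto cong: continuous_on_cong)
next
  case (Suc k)
  have *: "frechet_derivative f (at y) = frechet_derivative g (at y)" "g differentiable (at y)"
    if "y \<in> S" for y
  proof -
    have d: "f differentiable (at y)" using Suc that by auto
    show "frechet_derivative f (at y) = frechet_derivative g (at y)"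
      by (rule frechet_derivative_transform_within_open[OF d \<open>open S\<close> that]) (use Suc in auto)
    show "g differentiable (at y)"
      using d that \<open>open S\<close> Suc.prems(1)
      by (auto simp: differentiable_def intro: has_derivative_transform_within_open)
  qed
  have "Ck_on k S (\<lambda>y. frechet_derivative g (at y) w)" for w
    by (rule Suc.IH[of "\<lambda>y. frechet_derivative f (at y) w"]) (use * Suc in auto)
  with * show ?case by auto
qed

lemma Ck_on_SucI:
  assumes "open S" "\<And>y. y \<in> S \<Longrightarrow> (f has_derivative f' y) (at y)"
    and "\<And>w. Ck_on k S (\<lambda>y. f' y w)"
  shows "Ck_on (Suc k) S f"
proof -
  have "Ck_on k S (\<lambda>y. frechet_derivative f (at y) w)" for w
    by (rule Ck_on_cong[OF assms(1) _ assms(3)[of w]]) (simp add: frechet_derivative_at[OF assms(2)])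
  then show ?thesis using assms(2) by (auto simp: differentiable_def)
qed

lemma Ck_on_SucD:
  assumes "Ck_on (Suc k) S f"
  shows "y \<in> S \<Longrightarrow> (f has_derivative frechet_derivative f (at y)) (at y)"
    and "Ck_on k S (\<lambda>y. frechet_derivative f (at y) w)"
  using assms by (auto simp: frechet_derivative_works[symmetric])

lemma Ck_on_Suc_imp: "Ck_on (Suc k) S f \<Longrightarrow> Ck_on k S f"
proof (induction k arbitrary: f)
  case 0
  then show ?case
    by (simp add: continuous_at_imp_continuous_on differentiable_imp_continuous_within)
next
  case (Suc k)
  show ?case using Suc.prems Suc.IH by (subst Ck_on.simps) (simp only: Ck_on.simps, blast)
qed

lemma Ck_on_const: "Ck_on k S (\<lambda>y. c)"
  by (induction k arbitrary: c) (auto simp: frechet_derivative_const)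

lemma Ck_on_bounded_linear:
  assumes "open S" "bounded_linear L" "Ck_on k S f"
  shows "Ck_on k S (\<lambda>y. L (f y))"
  using assms(3)
proof (induction k arbitrary: f)
  case 0
  then show ?case using assms(2) by (auto intro: bounded_linear.continuous_on)
next
  case (Suc k)
  show ?case
    by (rule Ck_on_SucI[OF \<open>open S\<close>, where f' = "\<lambda>y w. L (frechet_derivative f (at y) w)"])
      (auto intro!: bounded_linear.has_derivative[OF assms(2)] Ck_on_SucD(1)[OF Suc.prems] Suc.IH
        Ck_on_SucD(2)[OF Suc.prems])
qed

lemma Ck_on_id: "open S \<Longrightarrow> Ck_on k S (\<lambda>y. y)"
proof (cases k)
  case (Suc j)
  assume "open S"
  then show ?thesis unfolding Suc by (rule Ck_on_SucI[where f' = "\<lambda>y w. w"]) (auto simp: Ck_on_const)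
qed auto

lemma Ck_on_add:
  assumes "open S" "Ck_on k S f" "Ck_on k S g"
  shows "Ck_on k S (\<lambda>y. f y + g y)"
  using assms(2,3)
proof (induction k arbitrary: f g)
  case 0
  then show ?case by (auto intro: continuous_on_add)
next
  case (Suc k)
  show ?case
    by (rule Ck_on_SucI[OF \<open>open S\<close>, where f' = "\<lambda>y w. frechet_derivative f (at y) w + frechet_derivative g (at y) w"])
      (auto intro!: has_derivative_add Ck_on_SucD(1)[OF Suc.prems(1)] Ck_on_SucD(1)[OF Suc.prems(2)]
         Suc.IH Ck_on_SucD(2)[OF Suc.prems(1)] Ck_on_SucD(2)[OF Suc.prems(2)])
qed

lemma Ck_on_mult:
  fixes f g :: "'e::euclidean_space \<Rightarrow> real"
  assumes "open S" "Ck_on k S f" "Ck_on k S g"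
  shows "Ck_on k S (\<lambda>y. f y * g y)"
  using assms(2,3)
proof (induction k arbitrary: f g)
  case 0
  then show ?case by (auto intro: continuous_on_mult)
next
  case (Suc k)
  show ?case
    by (rule Ck_on_SucI[OF \<open>open S\<close>, where f' = "\<lambda>y w. f y * frechet_derivative g (at y) w + frechet_derivative f (at y) w * g y"])
      (auto intro!: has_derivative_mult Ck_on_SucD(1)[OF Suc.prems(1)] Ck_on_SucD(1)[OF Suc.prems(2)]
         Ck_on_add[OF \<open>open S\<close>] Suc.IH Ck_on_SucD(2)[OF Suc.prems(1)] Ck_on_SucD(2)[OF Suc.prems(2)]
         Ck_on_Suc_imp[OF Suc.prems(1)] Ck_on_Suc_imp[OF Suc.prems(2)])
qed

lemma Ck_on_sum:
  assumes "open S" "\<And>i. i \<in> I \<Longrightarrow> Ck_on k S (f i)"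
  shows "Ck_on k S (\<lambda>y. \<Sum>i\<in>I. f i y)"
  using assms(2)
  by (induction I rule: infinite_finite_induct) (auto simp: Ck_on_const intro: Ck_on_add[OF assms(1)])

text \<open>The chain rule writes \<open>D(f \<circ> g)(y) w\<close> as \<open>\<Sum>\<^sub>b (Dg(y) w \<bullet> b) Df(g y) b\<close>, which
  reduces one order of differentiability of a composition to products and to compositions of one
  order less.\<close>

lemma Ck_on_compose:
  fixes f :: "'a::euclidean_space \<Rightarrow> real" and g :: "'e::euclidean_space \<Rightarrow> 'a"
  assumes "open S" "open T" "g ` S \<subseteq> T" "Ck_on k T f" "Ck_on k S g"
  shows "Ck_on k S (\<lambda>y. f (g y))"
  using assms(4,5)
proof (induction k arbitrary: f)
  case 0
  then show ?case using assms(3) by (auto intro: continuous_on_compose2)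
next
  case (Suc k)
  have lin: "frechet_derivative f (at (g y)) v = (\<Sum>b\<in>Basis. (v \<bullet> b) * frechet_derivative f (at (g y)) b)"
    if "y \<in> S" for y v
  proof -
    have "linear (frechet_derivative f (at (g y)))"
      using Suc.prems(1) that assms(3) by (intro linear_frechet_derivative) auto
    from linear_sum[OF this, of "\<lambda>b. (v \<bullet> b) *\<^sub>R b" Basis] this show ?thesis
      by (simp add: euclidean_representation linear_cmul)
  qed
  show ?case
  proof (rule Ck_on_SucI[OF \<open>open S\<close>, where f' = "\<lambda>y w. \<Sum>b\<in>Basis.
        (frechet_derivative g (at y) w \<bullet> b) * frechet_derivative f (at (g y)) b"])
    fix y assume y: "y \<in> S"
    with assms(3) have "g y \<in> T" by auto
    note D = has_derivative_compose[OF Ck_on_SucD(1)[OF Suc.prems(2) y] Ck_on_SucD(1)[OF Suc.prems(1) this]]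
    show "((\<lambda>y. f (g y)) has_derivative (\<lambda>w. \<Sum>b\<in>Basis.
        (frechet_derivative g (at y) w \<bullet> b) * frechet_derivative f (at (g y)) b)) (at y)"
      by (rule has_derivative_eq_rhs[OF D]) (rule ext, rule lin[OF y])
  next
    fix w
    show "Ck_on k S (\<lambda>y. \<Sum>b\<in>Basis. (frechet_derivative g (at y) w \<bullet> b) * frechet_derivative f (at (g y)) b)"
    proof (rule Ck_on_sum[OF \<open>open S\<close>], rule Ck_on_mult[OF \<open>open S\<close>])
      fix b :: 'a
      show "Ck_on k S (\<lambda>y. frechet_derivative g (at y) w \<bullet> b)"
        by (rule Ck_on_bounded_linear[OF \<open>open S\<close> bounded_linear_inner_left Ck_on_SucD(2)[OF Suc.prems(2)]])
      show "Ck_on k S (\<lambda>y. frechet_derivative f (at (g y)) b)"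
        by (rule Suc.IH[OF Ck_on_SucD(2)[OF Suc.prems(1)] Ck_on_Suc_imp[OF Suc.prems(2)]])
    qed
  qed
qed

lemma Ck_on_Un:
  assumes "open S" "open T" "Ck_on k S f" "Ck_on k T f"
  shows "Ck_on k (S \<union> T) f"
  using assms(3,4)
proof (induction k arbitrary: f)
  case 0
  then show ?case by (simp add: continuous_on_open_Un[OF assms(1,2)])
next
  case (Suc k)
  then show ?case by (simp add: ball_Un)
qed

text \<open>The function \<open>t \<mapsto> t\<^sup>-\<^sup>n exp(-1/t)\<close>, extended by \<open>0\<close> to \<open>t \<le> 0\<close>. The derivative of
  a member of this family is a linear combination of two others, so one induction over the order of
  differentiability, for all \<open>n\<close> at once, shows smoothness.\<close>

definition flat :: "nat \<Rightarrow> real \<Rightarrow> real"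
  where "flat n t = (if t > 0 then inverse t ^ n * exp (- inverse t) else 0)"

text \<open>The quadratic bound, from one term of the exponential series, gives the derivative at \<open>0\<close>.\<close>

lemma flat_bound: "\<bar>flat n t\<bar> \<le> fact (n + 2) * t\<^sup>2"
proof (cases "t > 0")
  case True
  define y where "y = inverse t"
  have y: "y > 0" and t: "t = inverse y" using True by (auto simp: y_def)
  have "(\<Sum>k\<in>{n + 2}. y ^ k /\<^sub>R fact k) \<le> (\<Sum>k. y ^ k /\<^sub>R fact k)"
    by (rule sum_le_suminf) (use y in \<open>auto simp: divide_inverse_commute intro: sums_summable[OF exp_converges] summable_exp\<close>)
  also have "\<dots> = exp y"
    by (rule sums_unique[OF exp_converges, symmetric])
  finally have "y ^ (n + 2) / fact (n + 2) \<le> exp y"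
    by (simp add: divide_inverse mult.commute del: fact_Suc)
  then have "y ^ n * y\<^sup>2 \<le> fact (n + 2) * exp y"
    by (simp add: divide_le_eq power_add power2_eq_square mult.commute del: fact_Suc)
  then have "y ^ n * exp (- y) \<le> fact (n + 2) * (inverse y)\<^sup>2"
    using y by (simp add: exp_minus field_simps del: fact_Suc)
  then show ?thesis using True y by (simp add: flat_def y_def del: fact_Suc)
qed (auto simp: flat_def)

lemma flat_has_derivative:
  "(flat n has_real_derivative flat (n + 2) t - real n * flat (n + 1) t) (at t)"
proof -
  consider "t > 0" | "t < 0" | "t = 0" by linarith
  then show ?thesis
  proof cases
    case 1
    have "((\<lambda>t. inverse t ^ n * exp (- inverse t)) has_real_derivative
        flat (n + 2) t - real n * flat (n + 1) t) (at t)"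
      using 1
      by (auto intro!: derivative_eq_intros simp: flat_def power2_eq_square algebra_simps
          simp flip: power_Suc2 split: nat.split)
        (cases n; simp add: algebra_simps)
    then show ?thesis
      by (rule has_field_derivative_transform_within_open[of _ _ _ "{0<..}"])
        (use 1 in \<open>auto simp: flat_def\<close>)
  next
    case 2
    have "((\<lambda>t. 0) has_real_derivative 0) (at t)" by simp
    then have "(flat n has_real_derivative 0) (at t)"
      by (rule has_field_derivative_transform_within_open[of _ _ _ "{..<0}"])
        (use 2 in \<open>auto simp: flat_def\<close>)
    with 2 show ?thesis by (simp add: flat_def)
  next
    case 3
    have "((\<lambda>h. flat n h / h) \<longlongrightarrow> 0) (at 0)"
    proof (rule Lim_null_comparison)
      show "\<forall>\<^sub>F h in at 0. norm (flat n h / h) \<le> fact (n + 2) * \<bar>h\<bar>"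
        using flat_bound[of n]
        by (auto simp: eventually_at_filter divide_le_eq power2_eq_square abs_mult_self_eq mult.assoc simp del: fact_Suc)
      show "((\<lambda>h::real. fact (n + 2) * \<bar>h\<bar>) \<longlongrightarrow> 0) (at 0)"
        by (auto intro!: tendsto_eq_intros simp del: fact_Suc)
    qed
    with 3 show ?thesis by (simp add: DERIV_def flat_def)
  qed
qed

lemma Ck_on_flat: "Ck_on k UNIV (flat n)"
proof (induction k arbitrary: n)
  case 0
  have "isCont (flat n) t" for t by (rule DERIV_isCont[OF flat_has_derivative])
  then show ?case by (simp add: continuous_at_imp_continuous_on)
next
  case (Suc k)
  show ?case
  proof (rule Ck_on_SucI[OF open_UNIV])
    show "(flat n has_derivative (\<lambda>w. (flat (n + 2) t + (- real n) * flat (n + 1) t) * w)) (at t)" for t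
      using flat_has_derivative[of n t] by (simp add: has_field_derivative_def)
    show "Ck_on k UNIV (\<lambda>t. (flat (n + 2) t + (- real n) * flat (n + 1) t) * w)" for w
      by (intro Ck_on_mult Ck_on_add Ck_on_const Suc.IH) auto
  qed
qed

text \<open>The function \<open>exp(-1/(b - t))\<close> vanishes from \<open>b\<close> on, and up to \<open>a\<close> it is at least its value
  \<open>K\<close> at \<open>a\<close>. So \<open>exp(-1/\<cdot>)\<close> applied to \<open>K - exp(-1/(b - t))\<close> is \<open>0\<close> up to \<open>a\<close> and constant and
  positive from \<open>b\<close> on. This yields a step without a quotient of functions.\<close>

lemma smooth_step:
  fixes a b :: real
  assumes "a < b"
  obtains \<eta> :: "real \<Rightarrow> real" where "smooth_on UNIV \<eta>"
    and "\<And>t. t \<le> a \<Longrightarrow> \<eta> t = 1" and "\<And>t. t \<ge> b \<Longrightarrow> \<eta> t = 0"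
proof -
  define K where "K = flat 0 (b - a)"
  have K: "K > 0" using assms by (simp add: K_def flat_def)
  have L: "flat 0 K > 0" using K by (simp add: flat_def)
  define \<eta> where "\<eta> = (\<lambda>t. 1 + (- inverse (flat 0 K)) * flat 0 (K + (- 1) * flat 0 (b + (- 1) * t)))"
  have "smooth_on UNIV \<eta>"
    unfolding smooth_on_def \<eta>_def
    by (intro allI Ck_on_add Ck_on_mult Ck_on_const Ck_on_id
        Ck_on_compose[OF open_UNIV open_UNIV subset_UNIV Ck_on_flat]) auto
  moreover have "\<eta> t = 1" if "t \<le> a" for t
  proof -
    have "K \<le> flat 0 (b - t)" using that assms by (auto simp: K_def flat_def)
    then show ?thesis by (simp add: \<eta>_def flat_def[of 0 "K - _"])
  qed
  moreover have "\<eta> t = 0" if "t \<ge> b" for t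
    using that L by (simp add: \<eta>_def flat_def[of 0 "b - _"])
  ultimately show ?thesis using that by blast
qed

lemma smooth_on_frechet_derivative:
  "smooth_on S f \<Longrightarrow> smooth_on S (\<lambda>y. frechet_derivative f (at y) w)"
  unfolding smooth_on_def using Ck_on_SucD(2) by blast

lemma smooth_on_differentiable: "smooth_on S f \<Longrightarrow> y \<in> S \<Longrightarrow> f differentiable (at y)"
  unfolding smooth_on_def by (metis Ck_on.simps(2))

lemma smooth_on_subset: "smooth_on S f \<Longrightarrow> T \<subseteq> S \<Longrightarrow> smooth_on T f"
  unfolding smooth_on_def using Ck_on_subset by blast

lemma smooth_on_cong: "open S \<Longrightarrow> (\<And>y. y \<in> S \<Longrightarrow> f y = g y) \<Longrightarrow> smooth_on S f \<Longrightarrow> smooth_on S g"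
  unfolding smooth_on_def using Ck_on_cong by blast

lemma smooth_on_bounded_linear: "open S \<Longrightarrow> bounded_linear L \<Longrightarrow> smooth_on S L"
  unfolding smooth_on_def using Ck_on_bounded_linear[OF _ _ Ck_on_id] by blast

lemma smooth_on_compose:
  fixes f :: "'a::euclidean_space \<Rightarrow> real" and g :: "'e::euclidean_space \<Rightarrow> 'a"
  assumes "open S" "open T" "g ` S \<subseteq> T" "smooth_on T f" "smooth_on S g"
  shows "smooth_on S (\<lambda>y. f (g y))"
  using assms unfolding smooth_on_def by (blast intro: Ck_on_compose)

section \<open>Smooth functions on a manifold\<close>

locale manifold =
  fixes M :: "('m, 'e::euclidean_space) smooth_manifold"
  assumes smooth_manifold: "smooth_manifold M"
begin

lemma chart_in_atlas: "c \<in> atlas M \<Longrightarrow> chart_in (topo M) c"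
  using smooth_manifold by (auto simp: smooth_manifold_def)

lemma chart_domain: "(W, \<phi>) \<in> atlas M \<Longrightarrow> openin (topo M) W"
  using chart_in_atlas by (fastforce simp: chart_in_def)

lemma chart_homeo: "(W, \<phi>) \<in> atlas M \<Longrightarrow>
    homeomorphic_map (subtopology (topo M) W) (top_of_set (\<phi> ` W)) \<phi>"
  using chart_in_atlas by (fastforce simp: chart_in_def)

lemma chart_inj:
  assumes "(W, \<phi>) \<in> atlas M" shows "inj_on \<phi> W"
  using homeomorphic_imp_injective_map[OF chart_homeo[OF assms]] openin_subset[OF chart_domain[OF assms]]
  by (simp add: topspace_subtopology Int_absorb1)

lemma inv_chart: "(W, \<phi>) \<in> atlas M \<Longrightarrow> p \<in> W \<Longrightarrow> inv_into W \<phi> (\<phi> p) = p"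
  by (simp add: chart_inj)

lemma open_chart_image:
  assumes "(W, \<phi>) \<in> atlas M" "openin (topo M) S"
  shows "open (\<phi> ` (W \<inter> S))"
proof -
  have "openin (top_of_set (\<phi> ` W)) (\<phi> ` (W \<inter> S))"
    using homeomorphic_imp_open_map[OF chart_homeo[OF assms(1)]] openin_subtopology_Int2[OF assms(2)]
    by (simp add: open_map_def)
  moreover have "open (\<phi> ` W)" using chart_in_atlas[OF assms(1)] by (simp add: chart_in_def)
  ultimately show ?thesis by (simp add: openin_open_eq)
qed

lemma chart_around:
  assumes "p \<in> points M" obtains W \<phi> where "(W, \<phi>) \<in> atlas M" "p \<in> W"
proof -
  have "p \<in> (\<Union>c\<in>atlas M. fst c)" using assms smooth_manifold by (simp add: smooth_manifold_def)
  then show ?thesis using that by fastforce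
qed

lemma transition_smooth:
  "(W, \<phi>) \<in> atlas M \<Longrightarrow> (W', \<psi>) \<in> atlas M \<Longrightarrow> smooth_on (\<phi> ` (W \<inter> W')) (\<psi> \<circ> inv_into W \<phi>)"
  using smooth_manifold by (fastforce simp: smooth_manifold_def)

lemma smooth_funD: "smooth_fun M S f \<Longrightarrow> (W, \<phi>) \<in> atlas M \<Longrightarrow> smooth_on (\<phi> ` (W \<inter> S)) (f \<circ> inv_into W \<phi>)"
  by (auto simp: smooth_fun_def)

lemma smooth_funI:
  "(\<And>W \<phi>. (W, \<phi>) \<in> atlas M \<Longrightarrow> smooth_on (\<phi> ` (W \<inter> S)) (f \<circ> inv_into W \<phi>)) \<Longrightarrow> smooth_fun M S f"
  by (auto simp: smooth_fun_def)

lemma smooth_fun_subset: "smooth_fun M S f \<Longrightarrow> T \<subseteq> S \<Longrightarrow> smooth_fun M T f"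
  by (rule smooth_funI, rule smooth_on_subset[OF smooth_funD]) auto

lemma smooth_fun_cong:
  assumes "openin (topo M) S" "smooth_fun M S f" "\<And>p. p \<in> S \<Longrightarrow> f p = g p"
  shows "smooth_fun M S g"
proof (rule smooth_funI)
  fix W \<phi> assume c: "(W, \<phi>) \<in> atlas M"
  show "smooth_on (\<phi> ` (W \<inter> S)) (g \<circ> inv_into W \<phi>)"
    by (rule smooth_on_cong[OF open_chart_image[OF c assms(1)] _ smooth_funD[OF assms(2) c]])
      (use assms(3) inv_chart[OF c] in auto)
qed

lemma smooth_fun_const: "smooth_fun M S (\<lambda>p. c)"
  by (rule smooth_funI) (simp add: o_def smooth_on_def Ck_on_const)

lemma smooth_fun_add:
  assumes "openin (topo M) S" "smooth_fun M S f" "smooth_fun M S g"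
  shows "smooth_fun M S (\<lambda>p. f p + g p)"
  using assms by (auto simp: smooth_fun_def smooth_on_def o_def intro!: Ck_on_add open_chart_image)

lemma smooth_fun_mult:
  assumes "openin (topo M) S" "smooth_fun M S f" "smooth_fun M S g"
  shows "smooth_fun M S (\<lambda>p. f p * g p)"
  using assms by (auto simp: smooth_fun_def smooth_on_def o_def intro!: Ck_on_mult open_chart_image)

lemma smooth_fun_Un:
  assumes "openin (topo M) S" "openin (topo M) T" "smooth_fun M S f" "smooth_fun M T f"
  shows "smooth_fun M (S \<union> T) f"
  using assms
  by (auto simp: smooth_fun_def smooth_on_def o_def Int_Un_distrib image_Un intro!: Ck_on_Un open_chart_image)

lemma smooth_fun_chart:
  assumes c: "(W, \<phi>) \<in> atlas M" and h: "smooth_on (\<phi> ` W) h"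
  shows "smooth_fun M W (\<lambda>p. h (\<phi> p))"
proof (rule smooth_funI)
  fix W' \<psi> assume c': "(W', \<psi>) \<in> atlas M"
  have "smooth_on (\<psi> ` (W' \<inter> W)) (\<lambda>y. h ((\<phi> \<circ> inv_into W' \<psi>) y))"
    by (rule smooth_on_compose[OF open_chart_image[OF c' chart_domain[OF c]] _ _ h transition_smooth[OF c' c]])
      (use open_chart_image[OF c chart_domain[OF c]] inv_chart[OF c'] in auto)
  then show "smooth_on (\<psi> ` (W' \<inter> W)) ((\<lambda>p. h (\<phi> p)) \<circ> inv_into W' \<psi>)" by (simp add: o_def)
qed

lemma smooth_fun_linear_coordinate:
  assumes c: "(W, \<phi>) \<in> atlas M" and h: "linear (h :: 'e \<Rightarrow> real)"
  shows "smooth_fun M W (\<lambda>p. h (\<phi> p))"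
  by (rule smooth_fun_chart[OF c smooth_on_bounded_linear])
    (use open_chart_image[OF c chart_domain[OF c]] h in \<open>auto simp: linear_linear\<close>)

text \<open>A function can be cut off outside a neighbourhood of a point because the preimage of a closed
  ball under a chart is compact, hence closed in a Hausdorff space: the complement of this set and the
  chart domain form an open cover on whose members smoothness is evident.\<close>

lemma smooth_fun_cutoff:
  assumes "openin (topo M) V" "x \<in> V"
  obtains \<kappa> C N where "closedin (topo M) C" "C \<subseteq> V" "\<And>p. p \<notin> C \<Longrightarrow> \<kappa> p = 0"
    and "openin (topo M) N" "x \<in> N" "N \<subseteq> C" "\<And>p. p \<in> N \<Longrightarrow> \<kappa> p = 1"
    and "smooth_fun M (topspace (topo M)) \<kappa>"
proof -
  have "x \<in> points M" using assms openin_subset by (fastforce simp: points_def)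
  then obtain W \<phi> where c: "(W, \<phi>) \<in> atlas M" and x: "x \<in> W" by (rule chart_around)
  have "open (\<phi> ` (W \<inter> V))" by (rule open_chart_image[OF c assms(1)])
  moreover have "\<phi> x \<in> \<phi> ` (W \<inter> V)" using x assms by auto
  ultimately obtain R where R: "R > 0" "cball (\<phi> x) R \<subseteq> \<phi> ` (W \<inter> V)"
    by (meson open_contains_cball)
  define h where "h = (\<lambda>y. \<Sum>b\<in>Basis. ((y \<bullet> b) + - (\<phi> x \<bullet> b)) * ((y \<bullet> b) + - (\<phi> x \<bullet> b)))"
  have h_norm: "h y = (norm (y - \<phi> x))\<^sup>2" for y
    unfolding h_def power2_norm_eq_inner by (subst euclidean_inner) (simp add: inner_diff_left)
  have cont_h: "continuous_on UNIV h" unfolding h_norm by (intro continuous_intros)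
  obtain \<eta> :: "real \<Rightarrow> real" where \<eta>: "smooth_on UNIV \<eta>" "\<And>t. t \<le> (R/2)\<^sup>2 \<Longrightarrow> \<eta> t = 1" "\<And>t. t \<ge> R\<^sup>2 \<Longrightarrow> \<eta> t = 0"
    by (rule smooth_step[of "(R/2)\<^sup>2" "R\<^sup>2"]) (use R in \<open>auto simp: power2_eq_square\<close>)
  define \<kappa> where "\<kappa> = (\<lambda>p. if p \<in> W then \<eta> (h (\<phi> p)) else 0)"
  define C where "C = inv_into W \<phi> ` cball (\<phi> x) R"
  define N where "N = {p \<in> W. \<phi> p \<in> ball (\<phi> x) (R/2)}"
  have sub: "W \<subseteq> topspace (topo M)" by (rule openin_subset[OF chart_domain[OF c]])
  have C_eq: "C = {p \<in> W. \<phi> p \<in> cball (\<phi> x) R}"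
  proof (intro equalityI subsetI)
    fix p assume "p \<in> C"
    then obtain y where y: "y \<in> cball (\<phi> x) R" "p = inv_into W \<phi> y" by (auto simp: C_def)
    with R obtain q where "q \<in> W" "y = \<phi> q" by blast
    with y show "p \<in> {p \<in> W. \<phi> p \<in> cball (\<phi> x) R}" by (simp add: inv_chart[OF c])
  qed (use inv_chart[OF c] in \<open>force simp: C_def\<close>)
  have CV: "C \<subseteq> V"
  proof
    fix p assume "p \<in> C"
    then have p: "p \<in> W" "\<phi> p \<in> cball (\<phi> x) R" by (auto simp: C_eq)
    with R obtain q where "q \<in> W \<inter> V" "\<phi> p = \<phi> q" by blast
    with p show "p \<in> V" using chart_inj[OF c] by (auto dest: inj_onD)
  qed
  have closed: "closedin (topo M) C"
  proof (rule compactin_imp_closedin)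
    show "Hausdorff_space (topo M)" using smooth_manifold by (simp add: smooth_manifold_def)
    obtain g where g: "homeomorphic_maps (subtopology (topo M) W) (top_of_set (\<phi> ` W)) \<phi> g"
      using chart_homeo[OF c] by (auto simp: homeomorphic_map_maps)
    have "compactin (top_of_set (\<phi> ` W)) (cball (\<phi> x) R)"
      using R by (auto simp: compactin_subtopology)
    then have "compactin (subtopology (topo M) W) (g ` cball (\<phi> x) R)"
      using g by (auto simp: homeomorphic_maps_def intro: image_compactin)
    then have "compactin (topo M) (g ` cball (\<phi> x) R)" by (simp add: compactin_subtopology)
    moreover have "g ` cball (\<phi> x) R = C"
      unfolding C_def
    proof (rule image_cong[OF refl])
      fix y assume "y \<in> cball (\<phi> x) R"
      with R obtain p where "p \<in> W" "y = \<phi> p" by blast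
      with g sub show "g y = inv_into W \<phi> y" by (auto simp: homeomorphic_maps_def inv_chart[OF c])
    qed
    ultimately show "compactin (topo M) C" by simp
  qed
  have zero: "\<kappa> p = 0" if "p \<notin> C" for p
    using that R \<eta>(3) by (auto simp: \<kappa>_def C_eq h_norm dist_norm norm_minus_commute intro!: \<eta>(3) power_mono)
  have N: "openin (topo M) N"
  proof -
    have "openin (subtopology (topo M) W) {p \<in> topspace (subtopology (topo M) W). \<phi> p \<in> \<phi> ` W \<inter> ball (\<phi> x) (R/2)}"
      using homeomorphic_imp_continuous_map[OF chart_homeo[OF c]]
      by (rule openin_continuous_map_preimage) (auto simp: openin_open)
    also have "{p \<in> topspace (subtopology (topo M) W). \<phi> p \<in> \<phi> ` W \<inter> ball (\<phi> x) (R/2)} = N"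
      using sub by (auto simp: N_def)
    finally show ?thesis using chart_domain[OF c] openin_trans_full by blast
  qed
  have one: "\<kappa> p = 1" if "p \<in> N" for p
    using that R by (auto simp: \<kappa>_def N_def h_norm dist_norm norm_minus_commute intro!: \<eta>(2) power_mono)
  have smooth: "smooth_fun M (topspace (topo M)) \<kappa>"
  proof -
    have "Ck_on k UNIV h" for k
      unfolding h_def
      by (intro Ck_on_sum Ck_on_mult Ck_on_add Ck_on_const open_UNIV
          Ck_on_bounded_linear[OF open_UNIV bounded_linear_inner_left] Ck_on_id)
    then have "smooth_on UNIV (\<lambda>y. \<eta> (h y))"
      by (intro smooth_on_compose[OF open_UNIV open_UNIV subset_UNIV \<eta>(1)]) (auto simp: smooth_on_def)
    then have "smooth_fun M W (\<lambda>p. \<eta> (h (\<phi> p)))"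
      by (intro smooth_fun_chart[OF c]) (rule smooth_on_subset, auto)
    then have 1: "smooth_fun M W \<kappa>"
      by (rule smooth_fun_cong[OF chart_domain[OF c]]) (simp add: \<kappa>_def)
    have o: "openin (topo M) (topspace (topo M) - C)" using closed by (simp add: closedin_def)
    have 2: "smooth_fun M (topspace (topo M) - C) \<kappa>"
      by (rule smooth_fun_cong[OF o smooth_fun_const[of _ 0]]) (simp add: zero)
    have "W \<union> (topspace (topo M) - C) = topspace (topo M)" using sub by (auto simp: C_eq)
    with smooth_fun_Un[OF chart_domain[OF c] o 1 2] show ?thesis by simp
  qed
  show thesis
    by (rule that[OF closed CV zero N _ _ one smooth]) (use R x in \<open>auto simp: N_def C_eq\<close>)
qed

lemma smooth_fun_extend_by_zero:
  assumes "openin (topo M) S" "openin (topo M) V" "closedin (topo M) C" "C \<subseteq> V"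
    and "\<And>p. p \<notin> C \<Longrightarrow> \<kappa> p = 0" and "smooth_fun M (topspace (topo M)) \<kappa>"
    and "smooth_fun M (S \<inter> V) h"
  shows "smooth_fun M S (\<lambda>p. if p \<in> V then \<kappa> p * h p else 0)"
proof -
  have o: "openin (topo M) (S \<inter> V)" "openin (topo M) (S - C)" using assms by (auto intro: openin_diff)
  have sub: "S \<inter> V \<subseteq> topspace (topo M)" using openin_subset[OF assms(1)] by auto
  have 1: "smooth_fun M (S \<inter> V) (\<lambda>p. if p \<in> V then \<kappa> p * h p else 0)"
    by (rule smooth_fun_cong[OF o(1) smooth_fun_mult[OF o(1) smooth_fun_subset[OF assms(6) sub] assms(7)]]) auto
  have 2: "smooth_fun M (S - C) (\<lambda>p. if p \<in> V then \<kappa> p * h p else 0)"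
    by (rule smooth_fun_cong[OF o(2) smooth_fun_const[of _ 0]]) (use assms(5) in auto)
  have "S \<inter> V \<union> (S - C) = S" using assms(4) by auto
  with smooth_fun_Un[OF o 1 2] show ?thesis by simp
qed

end

section \<open>Tangent vectors as derivations\<close>

lemma sum_fun_apply: "(\<Sum>i\<in>I. f i) y = (\<Sum>i\<in>I. f i y)"
  by (induction I rule: infinite_finite_induct) auto

lemma scaleR_fun_apply: "(k *\<^sub>R f) y = k *\<^sub>R f y"
  by (simp add: scaleR_fun_def)

context manifold
begin

lemma smooth_at_smooth_fun: "openin (topo M) S \<Longrightarrow> p \<in> S \<Longrightarrow> smooth_fun M S f \<Longrightarrow> smooth_at M p f"
  by (auto simp: smooth_at_def)

lemma smooth_at_common_nbhd:
  assumes "smooth_at M p f" "smooth_at M p g"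
  obtains S where "openin (topo M) S" "p \<in> S" "smooth_fun M S f" "smooth_fun M S g"
proof -
  obtain S T where "openin (topo M) S" "p \<in> S" "smooth_fun M S f"
    and "openin (topo M) T" "p \<in> T" "smooth_fun M T g"
    using assms by (auto simp: smooth_at_def)
  then show thesis
    using that[of "S \<inter> T"] by (blast intro: smooth_fun_subset openin_Int)
qed

lemma smooth_at_const: "p \<in> points M \<Longrightarrow> smooth_at M p (\<lambda>q. k)"
  by (rule smooth_at_smooth_fun[OF openin_topspace]) (auto simp: points_def smooth_fun_const)

lemma smooth_at_add: "smooth_at M p f \<Longrightarrow> smooth_at M p g \<Longrightarrow> smooth_at M p (\<lambda>q. f q + g q)"
  by (erule (1) smooth_at_common_nbhd) (blast intro: smooth_at_smooth_fun smooth_fun_add)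

lemma smooth_at_mult: "smooth_at M p f \<Longrightarrow> smooth_at M p g \<Longrightarrow> smooth_at M p (\<lambda>q. f q * g q)"
  by (erule (1) smooth_at_common_nbhd) (blast intro: smooth_at_smooth_fun smooth_fun_mult)

lemma smooth_at_points: "smooth_at M p f \<Longrightarrow> p \<in> points M"
  using openin_subset by (fastforce simp: smooth_at_def points_def)

lemma smooth_at_diff: "smooth_at M p f \<Longrightarrow> smooth_at M p g \<Longrightarrow> smooth_at M p (\<lambda>q. f q - g q)"
  using smooth_at_add[OF _ smooth_at_mult[OF smooth_at_const], of p f g "- 1"] smooth_at_points
  by simp

lemma smooth_at_sum:
  assumes "p \<in> points M" "\<And>i. i \<in> I \<Longrightarrow> smooth_at M p (f i)"
  shows "smooth_at M p (\<lambda>q. \<Sum>i\<in>I. f i q)"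
  using assms(2)
  by (induction I rule: infinite_finite_induct) (auto simp: smooth_at_const[OF assms(1)] intro: smooth_at_add)

lemma smooth_at_cong:
  assumes "openin (topo M) N" "p \<in> N" "\<And>q. q \<in> N \<Longrightarrow> f q = g q" "smooth_at M p f"
  shows "smooth_at M p g"
proof -
  obtain S where S: "openin (topo M) S" "p \<in> S" "smooth_fun M S f" using assms(4) by (auto simp: smooth_at_def)
  have o: "openin (topo M) (S \<inter> N)" using S assms by auto
  have "smooth_fun M (S \<inter> N) g"
    by (rule smooth_fun_cong[OF o smooth_fun_subset[OF S(3)]]) (use assms in auto)
  with o S assms show ?thesis by (auto simp: smooth_at_def)
qed

lemma differentiable_chart:
  assumes c: "(W, \<phi>) \<in> atlas M" and "p \<in> W" "smooth_at M p f"
  shows "(f \<circ> inv_into W \<phi>) differentiable (at (\<phi> p))"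
proof -
  obtain S where S: "openin (topo M) S" "p \<in> S" "smooth_fun M S f" using assms(3) by (auto simp: smooth_at_def)
  then show ?thesis
    using smooth_on_differentiable[OF smooth_funD[OF S(3) c]] assms(2) by blast
qed

lemma chart_vector_apply:
  "smooth_at M p f \<Longrightarrow> chart_vector M (W, \<phi>) p w f = frechet_derivative (f \<circ> inv_into W \<phi>) (at (\<phi> p)) w"
  by (simp add: chart_vector_def)

text \<open>Tangent vectors in different charts correspond under the derivative of the transition map, so
  any single chart around \<open>p\<close> parametrises the whole tangent space at \<open>p\<close>.\<close>

lemma chart_vector_change:
  assumes c: "(W, \<phi>) \<in> atlas M" "p \<in> W" and c': "(W', \<psi>) \<in> atlas M" "p \<in> W'"
  shows "chart_vector M (W, \<phi>) p w =
    chart_vector M (W', \<psi>) p (frechet_derivative (\<psi> \<circ> inv_into W \<phi>) (at (\<phi> p)) w)"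
proof
  fix f
  show "chart_vector M (W, \<phi>) p w f =
    chart_vector M (W', \<psi>) p (frechet_derivative (\<psi> \<circ> inv_into W \<phi>) (at (\<phi> p)) w) f"
  proof (cases "smooth_at M p f")
    case True
    let ?t = "\<psi> \<circ> inv_into W \<phi>" and ?f = "f \<circ> inv_into W' \<psi>"
    have t: "?t differentiable (at (\<phi> p))"
      by (rule smooth_on_differentiable[OF transition_smooth[OF c(1) c'(1)]]) (use c c' in auto)
    have tp: "?t (\<phi> p) = \<psi> p" using c by (simp add: inv_chart)
    have f: "?f differentiable (at (?t (\<phi> p)))"
      unfolding tp by (rule differentiable_chart[OF c' True])
    have eq: "frechet_derivative (?f \<circ> ?t) (at (\<phi> p)) = frechet_derivative (f \<circ> inv_into W \<phi>) (at (\<phi> p))"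
      by (rule frechet_derivative_transform_within_open[OF differentiable_chain_at[OF t f]
          open_chart_image[OF c(1) chart_domain[OF c'(1)]]])
        (use c c' inv_chart[OF c(1)] inv_chart[OF c'(1)] in auto)
    show ?thesis
      unfolding chart_vector_apply[OF True] eq[symmetric] frechet_derivative_compose[OF t f] tp
      by (rule comp_apply)
  qed (simp add: chart_vector_def)
qed

lemma tangent_space_chart:
  assumes "(W, \<phi>) \<in> atlas M" "p \<in> W"
  shows "tangent_space M p = range (chart_vector M (W, \<phi>) p)"
proof -
  have "\<exists>u. chart_vector M c' p w = chart_vector M (W, \<phi>) p u" if "c' \<in> atlas M" "p \<in> fst c'" for c' w
    using chart_vector_change[of "fst c'" "snd c'"] that assms by (metis prod.collapse)
  with assms show ?thesis unfolding tangent_space_def by fastforce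
qed

lemma linear_chart_vector:
  assumes c: "(W, \<phi>) \<in> atlas M" "p \<in> W"
  shows "linear (chart_vector M (W, \<phi>) p)"
proof -
  have "linear (frechet_derivative (f \<circ> inv_into W \<phi>) (at (\<phi> p)))" if "smooth_at M p f" for f
    by (rule linear_frechet_derivative[OF differentiable_chart[OF c that]])
  note L = linear_add[OF this] linear_cmul[OF this]
  show ?thesis by (rule linearI) (auto simp: fun_eq_iff chart_vector_def scaleR_fun_apply L)
qed

lemma subspace_tangent_space:
  assumes "p \<in> points M" shows "subspace (tangent_space M p)"
proof -
  obtain W \<phi> where c: "(W, \<phi>) \<in> atlas M" "p \<in> W" by (rule chart_around[OF assms])
  show ?thesis
    unfolding tangent_space_chart[OF c]
    using linear_subspace_image[OF linear_chart_vector[OF c] subspace_UNIV] .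
qed

lemma tangent_vector_chart:
  assumes "v \<in> tangent_space M p"
  obtains W \<phi> w where "(W, \<phi>) \<in> atlas M" "p \<in> W" "v = chart_vector M (W, \<phi>) p w"
  using assms by (auto simp: tangent_space_def)

text \<open>The value of a tangent vector depends only on the germ of the function. So identities between
  functions need to hold only near \<open>p\<close>, for instance where a cutoff function is \<open>1\<close>.\<close>

lemma tangent_cong:
  assumes v: "v \<in> tangent_space M p" and N: "openin (topo M) N" "p \<in> N" "\<And>q. q \<in> N \<Longrightarrow> f q = g q"
  shows "v f = v g"
proof -
  obtain W \<phi> w where c: "(W, \<phi>) \<in> atlas M" "p \<in> W" and v: "v = chart_vector M (W, \<phi>) p w"
    using v by (rule tangent_vector_chart)
  have iff: "smooth_at M p f \<longleftrightarrow> smooth_at M p g"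
    using smooth_at_cong[OF N(1,2), of f g] smooth_at_cong[OF N(1,2), of g f] N(3) by auto
  show ?thesis
  proof (cases "smooth_at M p f")
    case True
    have "frechet_derivative (f \<circ> inv_into W \<phi>) (at (\<phi> p)) = frechet_derivative (g \<circ> inv_into W \<phi>) (at (\<phi> p))"
      by (rule frechet_derivative_transform_within_open[OF differentiable_chart[OF c True]
            open_chart_image[OF c(1) N(1)]])
        (use c N inv_chart[OF c(1)] in auto)
    with True iff show ?thesis by (simp add: v chart_vector_apply)
  qed (use iff in \<open>simp add: v chart_vector_def\<close>)
qed

lemma tangent_has_derivative:
  assumes "(W, \<phi>) \<in> atlas M" "p \<in> W" "smooth_at M p f"
  shows "((f \<circ> inv_into W \<phi>) has_derivative (\<lambda>w. chart_vector M (W, \<phi>) p w f)) (at (\<phi> p))"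
  using differentiable_chart[OF assms] by (simp add: chart_vector_apply[OF assms(3)] frechet_derivative_works)

lemma chart_vector_eqI:
  assumes "smooth_at M p f" "((f \<circ> inv_into W \<phi>) has_derivative D) (at (\<phi> p))"
  shows "chart_vector M (W, \<phi>) p w f = D w"
  using assms by (simp add: chart_vector_apply frechet_derivative_at[symmetric])

lemma tangent_const: "v \<in> tangent_space M p \<Longrightarrow> p \<in> points M \<Longrightarrow> v (\<lambda>q. k) = 0"
  by (erule tangent_vector_chart) (auto intro!: chart_vector_eqI[where D = "\<lambda>w. 0"] smooth_at_const simp: o_def)

lemma tangent_add:
  assumes "v \<in> tangent_space M p" "smooth_at M p f" "smooth_at M p g"
  shows "v (\<lambda>q. f q + g q) = v f + v g"
proof -
  obtain W \<phi> w where c: "(W, \<phi>) \<in> atlas M" "p \<in> W" and v: "v = chart_vector M (W, \<phi>) p w"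
    using assms(1) by (rule tangent_vector_chart)
  show ?thesis
    unfolding v
    by (rule chart_vector_eqI[OF smooth_at_add[OF assms(2,3)]])
      (use has_derivative_add[OF tangent_has_derivative[OF c assms(2)] tangent_has_derivative[OF c assms(3)]]
        in \<open>simp add: o_def\<close>)
qed

lemma tangent_mult:
  assumes "v \<in> tangent_space M p" "smooth_at M p f" "smooth_at M p g"
  shows "v (\<lambda>q. f q * g q) = f p * v g + v f * g p"
proof -
  obtain W \<phi> w where c: "(W, \<phi>) \<in> atlas M" "p \<in> W" and v: "v = chart_vector M (W, \<phi>) p w"
    using assms(1) by (rule tangent_vector_chart)
  show ?thesis
    unfolding v
    by (rule chart_vector_eqI[OF smooth_at_mult[OF assms(2,3)]])
      (use has_derivative_mult[OF tangent_has_derivative[OF c assms(2)] tangent_has_derivative[OF c assms(3)]]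
        in \<open>simp add: o_def inv_chart[OF c]\<close>)
qed

lemma tangent_diff:
  assumes "v \<in> tangent_space M p" "smooth_at M p f" "smooth_at M p g"
  shows "v (\<lambda>q. f q - g q) = v f - v g"
  using tangent_add[OF assms(1) smooth_at_diff[OF assms(2,3)] assms(3)] by simp

lemma tangent_sum:
  assumes "v \<in> tangent_space M p" "p \<in> points M" "\<And>i. i \<in> I \<Longrightarrow> smooth_at M p (f i)"
  shows "v (\<lambda>q. \<Sum>i\<in>I. f i q) = (\<Sum>i\<in>I. v (f i))"
  using assms(3)
  by (induction I rule: infinite_finite_induct)
    (auto simp: tangent_const[OF assms(1,2)] intro!: tangent_add[OF assms(1), THEN trans] smooth_at_sum[OF assms(2)])

lemma chart_vector_coordinate:
  assumes c: "(W, \<phi>) \<in> atlas M" "p \<in> W" and h: "linear h"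
  shows "chart_vector M (W, \<phi>) p w (\<lambda>q. h (\<phi> q)) = h w"
proof (rule chart_vector_eqI)
  show "smooth_at M p (\<lambda>q. h (\<phi> q))"
    by (rule smooth_at_smooth_fun[OF chart_domain[OF c(1)] c(2) smooth_fun_linear_coordinate[OF c(1) h]])
  have "(h has_derivative h) (at (\<phi> p))" using h by (simp add: bounded_linear_imp_has_derivative linear_linear)
  then show "((\<lambda>q. h (\<phi> q)) \<circ> inv_into W \<phi> has_derivative h) (at (\<phi> p))"
    by (rule has_derivative_transform_within_open[OF _ open_chart_image[OF c(1) chart_domain[OF c(1)]]])
      (use c inv_chart[OF c(1)] in auto)
qed

lemma differential_in_cotangent_space:
  assumes "p \<in> points M" shows "differential M p f \<in> cotangent_space M p"
  using subspace_tangent_space[OF assms]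
  by (auto simp: cotangent_space_def dual_space_def linear_form_on_def differential_def scaleR_fun_apply
      subspace_add subspace_scale)

text \<open>Cut off the linear function of the coordinates that the covector defines.\<close>

lemma covector_is_differential:
  assumes x: "x \<in> points M" and \<alpha>: "\<alpha> \<in> cotangent_space M x"
  obtains f where "smooth_fun M (points M) f" "differential M x f = \<alpha>"
proof -
  obtain W \<phi> where c: "(W, \<phi>) \<in> atlas M" "x \<in> W" by (rule chart_around[OF x])
  define h where "h w = \<alpha> (chart_vector M (W, \<phi>) x w)" for w
  have \<alpha>': "linear_form_on (tangent_space M x) \<alpha>" "\<And>v. v \<notin> tangent_space M x \<Longrightarrow> \<alpha> v = 0"
    using \<alpha> by (auto simp: cotangent_space_def dual_space_def)
  have "linear h"
    by (rule linearI) (use \<alpha>'(1) in \<open>auto simp: h_def linear_form_on_def tangent_space_chart[OF c]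
      linear_add[OF linear_chart_vector[OF c]] linear_cmul[OF linear_chart_vector[OF c]]\<close>)
  obtain \<kappa> C N where \<kappa>: "closedin (topo M) C" "C \<subseteq> W" "\<And>p. p \<notin> C \<Longrightarrow> \<kappa> p = 0"
    and N: "openin (topo M) N" "x \<in> N" "N \<subseteq> C" "\<And>p. p \<in> N \<Longrightarrow> \<kappa> p = 1"
    and sm: "smooth_fun M (topspace (topo M)) \<kappa>"
    by (rule smooth_fun_cutoff[OF chart_domain[OF c(1)] c(2)]) blast
  define f where "f p = (if p \<in> W then \<kappa> p * h (\<phi> p) else 0)" for p
  have f: "smooth_fun M (points M) f"
    unfolding f_def points_def
    by (rule smooth_fun_extend_by_zero[OF openin_topspace chart_domain[OF c(1)] \<kappa>(1,2) _ sm])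
      (auto simp: \<kappa>(3) intro: smooth_fun_subset[OF smooth_fun_linear_coordinate[OF c(1) \<open>linear h\<close>]])
  have "differential M x f v = \<alpha> v" for v
  proof (cases "v \<in> tangent_space M x")
    case True
    then obtain w where w: "v = chart_vector M (W, \<phi>) x w" by (auto simp: tangent_space_chart[OF c])
    have "v f = v (\<lambda>q. h (\<phi> q))"
      by (rule tangent_cong[OF True N(1,2)]) (use \<kappa>(2) N in \<open>auto simp: f_def\<close>)
    also have "\<dots> = \<alpha> v" using chart_vector_coordinate[OF c \<open>linear h\<close>, of w] by (simp add: w h_def)
    finally show ?thesis using True by (simp add: differential_def)
  qed (simp add: differential_def \<alpha>')
  with f show thesis using that by blast
qed

lemma smooth_fun_section_apply:
  assumes X: "smooth_section M (tangent_bundle M) S X" and o: "openin (topo M) S" "openin (topo M) T"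
    and f: "smooth_fun M T f"
  shows "smooth_fun M (S \<inter> T) (\<lambda>p. X p f)"
proof (rule smooth_funI)
  fix W \<phi> assume c: "(W, \<phi>) \<in> atlas M"
  obtain b :: "nat \<Rightarrow> 'e" where b: "bij_betw b {..<DIM('e)} Basis"
    using ex_bij_betw_nat_finite[of "Basis :: 'e set"] by (auto simp: atLeast0LessThan)
  have "(W, \<lambda>i p. chart_vector M (W, \<phi>) p (b i)) \<in> frames (tangent_bundle M)"
    using c b by (auto simp: tangent_bundle_def)
  with X obtain a where a: "\<And>i. i < DIM('e) \<Longrightarrow> smooth_fun M (W \<inter> S) (a i)"
    and Xa: "\<And>p. p \<in> W \<inter> S \<Longrightarrow> X p = (\<Sum>i<DIM('e). a i p *\<^sub>R chart_vector M (W, \<phi>) p (b i))"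
    unfolding smooth_section_def by (force simp: tangent_bundle_def)
  let ?O = "\<phi> ` (W \<inter> (S \<inter> T))"
  have O: "open ?O" using open_chart_image[OF c] o by blast
  have "smooth_on ?O (a i \<circ> inv_into W \<phi>)" if "i < DIM('e)" for i
    by (rule smooth_on_subset[OF smooth_funD[OF a[OF that] c]]) auto
  moreover have "smooth_on ?O (\<lambda>y. frechet_derivative (f \<circ> inv_into W \<phi>) (at y) (b i))" for i
    by (rule smooth_on_subset[OF smooth_on_frechet_derivative[OF smooth_funD[OF f c]]]) auto
  ultimately have "smooth_on ?O (\<lambda>y. \<Sum>i<DIM('e).
      (a i \<circ> inv_into W \<phi>) y * frechet_derivative (f \<circ> inv_into W \<phi>) (at y) (b i))"
    unfolding smooth_on_def by (intro allI Ck_on_sum[OF O] Ck_on_mult[OF O]) (simp_all del: o_apply)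
  then show "smooth_on ?O ((\<lambda>p. X p f) \<circ> inv_into W \<phi>)"
  proof (rule smooth_on_cong[OF O, rotated])
    fix y assume "y \<in> ?O"
    then obtain p where p: "p \<in> W" "p \<in> S" "p \<in> T" "y = \<phi> p" by auto
    then show "(\<Sum>i<DIM('e). (a i \<circ> inv_into W \<phi>) y * frechet_derivative (f \<circ> inv_into W \<phi>) (at y) (b i))
        = ((\<lambda>p. X p f) \<circ> inv_into W \<phi>) y"
      by (simp add: inv_chart[OF c] Xa sum_fun_apply scaleR_fun_apply
          chart_vector_apply[OF smooth_at_smooth_fun[OF o(2) p(3) f]])
  qed
qed

text \<open>The product rule for \<open>h = {f, g}\<close>, where \<open>F i\<close> and \<open>G i\<close> stand for the derivatives of \<open>f\<close> and \<open>g\<close>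
  along a finite family of vector fields. This family is either a coordinate frame, in which the
  coefficients \<open>c i j\<close> vanish at \<open>x\<close>, or the image under the anchor of a frame of an algebroid, in which
  \<open>G i\<close> (and sometimes \<open>F i\<close>) vanishes at \<open>x\<close>.\<close>

lemma tangent_apply_bivector_expansion:
  fixes r :: nat
  assumes v: "v \<in> tangent_space M x" and N: "openin (topo M) N" "x \<in> N"
    and h: "\<And>p. p \<in> N \<Longrightarrow> h p = (\<Sum>j<r. \<Sum>i<j. c i j p * (F i p * G j p - F j p * G i p))"
    and c: "\<And>i j. smooth_at M x (c i j)"
    and F: "\<And>i. i < r \<Longrightarrow> smooth_at M x (F i)" and G: "\<And>i. i < r \<Longrightarrow> smooth_at M x (G i)"
  shows "v h = (\<Sum>j<r. \<Sum>i<j. c i j x * (F i x * v (G j) + v (F i) * G j x - (F j x * v (G i) + v (F j) * G i x))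
    + v (c i j) * (F i x * G j x - F j x * G i x))"
proof -
  have x: "x \<in> points M" using c by (rule smooth_at_points)
  have "v h = v (\<lambda>p. \<Sum>j<r. \<Sum>i<j. c i j p * (F i p * G j p - F j p * G i p))"
    by (rule tangent_cong[OF v N h])
  also have "\<dots> = (\<Sum>j<r. v (\<lambda>p. \<Sum>i<j. c i j p * (F i p * G j p - F j p * G i p)))"
    by (rule tangent_sum[OF v x])
      (auto intro!: smooth_at_sum[OF x] smooth_at_mult smooth_at_diff c F G)
  also have "\<dots> = (\<Sum>j<r. \<Sum>i<j. v (\<lambda>p. c i j p * (F i p * G j p - F j p * G i p)))"
    by (intro sum.cong refl tangent_sum[OF v x])
      (auto intro!: smooth_at_mult smooth_at_diff c F G)
  also have "\<dots> = (\<Sum>j<r. \<Sum>i<j. c i j x * (F i x * v (G j) + v (F i) * G j x - (F j x * v (G i) + v (F j) * G i x))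
    + v (c i j) * (F i x * G j x - F j x * G i x))"
    by (intro sum.cong refl)
      (simp add: tangent_mult[OF v] tangent_diff[OF v] smooth_at_mult smooth_at_diff c F G)
  finally show ?thesis .
qed

end

section \<open>The isotropy Lie algebra\<close>

context manifold
begin

lemma chart_vector_in_tangent_space:
  "(W, \<phi>) \<in> atlas M \<Longrightarrow> p \<in> W \<Longrightarrow> chart_vector M (W, \<phi>) p w \<in> tangent_space M p"
  by (simp add: tangent_space_chart)

lemma chart_domain_points: "(W, \<phi>) \<in> atlas M \<Longrightarrow> W \<subseteq> points M"
  using openin_subset[OF chart_domain] by (simp add: points_def)

lemma differential_apply: "v \<in> tangent_space M p \<Longrightarrow> differential M p f v = v f"
  by (simp add: differential_def)

lemma poisson_bracket_chart_expansion:
  assumes \<pi>: "bivector_field M (points M) (tangent_bundle M) \<pi>"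
    and c: "(W, \<phi>) \<in> atlas M" and b: "bij_betw b {..<DIM('e)} Basis"
  obtains a where "\<And>i j. smooth_fun M W (a i j)"
    and "\<And>p f g. p \<in> W \<Longrightarrow> poisson_bracket M \<pi> f g p = (\<Sum>j<DIM('e). \<Sum>i<j. a i j p *
      (chart_vector M (W, \<phi>) p (b i) f * chart_vector M (W, \<phi>) p (b j) g
       - chart_vector M (W, \<phi>) p (b j) f * chart_vector M (W, \<phi>) p (b i) g))"
proof -
  have W: "W \<inter> points M = W" using chart_domain_points[OF c] by auto
  have "(W, \<lambda>i p. chart_vector M (W, \<phi>) p (b i)) \<in> frames (tangent_bundle M)"
    using c b by (auto simp: tangent_bundle_def)
  with \<pi> obtain a where a: "\<And>i j. smooth_fun M W (a i j)"
    and \<pi>a: "\<And>p. p \<in> W \<Longrightarrow> \<pi> p = (\<Sum>j<DIM('e). \<Sum>i<j. a i j p *\<^sub>R wedge2 (tangent_space M p)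
        (chart_vector M (W, \<phi>) p (b i)) (chart_vector M (W, \<phi>) p (b j)))"
    unfolding bivector_field_def by (force simp: tangent_bundle_def W)
  show thesis
  proof (rule that[OF a])
    fix p f g assume p: "p \<in> W"
    then have "differential M p f \<in> dual_space (tangent_space M p)" for f
      using differential_in_cotangent_space chart_domain_points[OF c] by (auto simp: cotangent_space_def)
    then show "poisson_bracket M \<pi> f g p = (\<Sum>j<DIM('e). \<Sum>i<j. a i j p *
      (chart_vector M (W, \<phi>) p (b i) f * chart_vector M (W, \<phi>) p (b j) g
       - chart_vector M (W, \<phi>) p (b j) f * chart_vector M (W, \<phi>) p (b i) g))"
      by (simp add: poisson_bracket_def \<pi>a[OF p] sum_fun_apply scaleR_fun_apply wedge2_def
          differential_apply chart_vector_in_tangent_space[OF c p])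
  qed
qed

text \<open>At a zero of \<open>\<pi>\<close> the coefficients of \<open>\<pi>\<close> in a coordinate frame vanish, so only their
  derivatives contribute to the derivative of \<open>{f, g}\<close>, and they are multiplied with first
  derivatives of \<open>f\<close> and \<open>g\<close>. This makes the bracket of two covectors independent of the functions
  that represent them.\<close>

lemma differential_poisson_bracket_cong:
  assumes \<pi>: "bivector_field M (points M) (tangent_bundle M) \<pi>" and x: "isotropy_point M \<pi> x"
    and f: "smooth_fun M (points M) f" "smooth_fun M (points M) f'" "differential M x f = differential M x f'"
    and g: "smooth_fun M (points M) g" "smooth_fun M (points M) g'" "differential M x g = differential M x g'"
  shows "differential M x (poisson_bracket M \<pi> f g) = differential M x (poisson_bracket M \<pi> f' g')"
proof -
  have xM: "x \<in> points M" and \<pi>x: "\<pi> x = 0" using x by (auto simp: isotropy_point_def)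
  obtain W \<phi> where c: "(W, \<phi>) \<in> atlas M" "x \<in> W" by (rule chart_around[OF xM])
  obtain b :: "nat \<Rightarrow> 'e" where b: "bij_betw b {..<DIM('e)} Basis"
    using ex_bij_betw_nat_finite[of "Basis :: 'e set"] by (auto simp: atLeast0LessThan)
  let ?E = "\<lambda>i p. chart_vector M (W, \<phi>) p (b i)"
  obtain a where a: "\<And>i j. smooth_fun M W (a i j)"
    and exp: "\<And>p f g. p \<in> W \<Longrightarrow> poisson_bracket M \<pi> f g p =
      (\<Sum>j<DIM('e). \<Sum>i<j. a i j p * (?E i p f * ?E j p g - ?E j p f * ?E i p g))"
    using poisson_bracket_chart_expansion[OF \<pi> c(1) b] by blast
  \<comment> \<open>The coefficient at \<open>i < j\<close> is the bracket of the \<open>i\<close>-th and \<open>j\<close>-th coordinate functions.\<close>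
  have a0: "a i j x = 0" if "i < j" "j < DIM('e)" for i j
  proof -
    have E: "?E k x (\<lambda>q. b l \<bullet> \<phi> q) = (if k = l then 1 else 0)" if "k < DIM('e)" "l < DIM('e)" for k l
    proof -
      have "b k \<in> Basis" "b l \<in> Basis" "b k = b l \<longleftrightarrow> k = l"
        using b that by (auto simp: bij_betw_def inj_on_def)
      then show ?thesis
        using chart_vector_coordinate[OF c, of "\<lambda>y. b l \<bullet> y" "b k"]
        by (auto simp: inner_Basis bounded_linear.linear[OF bounded_linear_inner_right])
    qed
    have "0 = poisson_bracket M \<pi> (\<lambda>q. b i \<bullet> \<phi> q) (\<lambda>q. b j \<bullet> \<phi> q) x"
      by (simp add: poisson_bracket_def \<pi>x)
    also have "\<dots> = (\<Sum>j'<DIM('e). \<Sum>i'<j'. if j' = j then if i' = i then a i' j' x else 0 else 0)"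
      unfolding exp[OF c(2)] using that by (intro sum.cong refl) (auto simp: E)
    also have "\<dots> = (\<Sum>j'<DIM('e). if j' = j then a i j x else 0)"
      using that by (intro sum.cong refl) auto
    finally show ?thesis using that by simp
  qed
  have smE: "smooth_at M x (\<lambda>p. ?E i p f)" if f: "smooth_fun M (points M) f" for i f
  proof -
    have W: "W \<inter> points M = W" using chart_domain_points[OF c(1)] by auto
    have "smooth_fun M W (\<lambda>p. frechet_derivative (f \<circ> inv_into W \<phi>) (at (\<phi> p)) (b i))"
      using smooth_on_frechet_derivative[OF smooth_funD[OF f c(1)]] by (intro smooth_fun_chart[OF c(1)]) (simp only: W)
    then have "smooth_fun M W (\<lambda>p. ?E i p f)"
    proof (rule smooth_fun_cong[OF chart_domain[OF c(1)]])
      fix p assume "p \<in> W"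
      then have "smooth_at M p f"
        using smooth_at_smooth_fun[OF openin_topspace _ f[unfolded points_def]] W by (auto simp: points_def)
      then show "frechet_derivative (f \<circ> inv_into W \<phi>) (at (\<phi> p)) (b i) = ?E i p f"
        by (simp add: chart_vector_apply)
    qed
    then show ?thesis by (rule smooth_at_smooth_fun[OF chart_domain[OF c(1)] c(2)])
  qed
  have key: "v (poisson_bracket M \<pi> f g) = (\<Sum>j<DIM('e). \<Sum>i<j. v (a i j) *
      (differential M x f (?E i x) * differential M x g (?E j x) - differential M x f (?E j x) * differential M x g (?E i x)))"
    if v: "v \<in> tangent_space M x" and f: "smooth_fun M (points M) f" and g: "smooth_fun M (points M) g" for v f g
    by (subst tangent_apply_bivector_expansion[OF v chart_domain[OF c(1)] c(2) exp])
      (auto intro!: sum.cong smE f g smooth_at_smooth_fun[OF chart_domain[OF c(1)] c(2) a]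
        simp: a0 differential_apply chart_vector_in_tangent_space[OF c])
  show ?thesis
    using key[OF _ f(1) g(1)] key[OF _ f(2) g(2)] f(3) g(3) by (auto simp: differential_def fun_eq_iff)
qed

lemma isotropy_bracket_differential:
  assumes "bivector_field M (points M) (tangent_bundle M) \<pi>" "isotropy_point M \<pi> x"
    and "smooth_fun M (points M) f" "smooth_fun M (points M) g"
  shows "isotropy_bracket M \<pi> x (differential M x f) (differential M x g) = differential M x (poisson_bracket M \<pi> f g)"
  unfolding isotropy_bracket_def
  by (rule the_equality) (use assms differential_poisson_bracket_cong[OF assms(1,2)] in blast)+

end

section \<open>Lie algebroids\<close>

locale algebroid = manifold M for M :: "('m, 'e::euclidean_space) smooth_manifold" +
  fixes U :: "'m set" and A :: "('m, 'v::real_vector) lie_algebroid"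
  assumes lie_algebroid: "lie_algebroid M U A"
begin

lemma vector_bundle: "vector_bundle M U A"
  using lie_algebroid by (simp add: lie_algebroid_def)

lemma open_base: "openin (topo M) U"
  using vector_bundle by (simp add: vector_bundle_def)

lemma base_points: "U \<subseteq> points M"
  using openin_subset[OF open_base] by (simp add: points_def)

lemma frame_domain: "(W, e) \<in> frames A \<Longrightarrow> openin (topo M) W \<and> W \<subseteq> U"
  using vector_bundle by (fastforce simp: vector_bundle_def)

lemma frame_basis: "(W, e) \<in> frames A \<Longrightarrow> p \<in> W \<Longrightarrow> basis_family (fibre A p) (vb_rank A) (\<lambda>i. e i p)"
  using vector_bundle by (fastforce simp: vector_bundle_def)

lemma frame_smooth: "(W, e) \<in> frames A \<Longrightarrow> i < vb_rank A \<Longrightarrow> smooth_section M A W (e i)"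
  using vector_bundle by (fastforce simp: vector_bundle_def)

lemma frame_around:
  assumes "p \<in> U" obtains W e where "(W, e) \<in> frames A" "p \<in> W"
  using assms vector_bundle unfolding vector_bundle_def by fastforce

lemma frame_span: "(W, e) \<in> frames A \<Longrightarrow> p \<in> W \<Longrightarrow> fibre A p = span ((\<lambda>i. e i p) ` {..<vb_rank A})"
  using frame_basis by (fastforce simp: basis_family_def)

lemma frame_in_fibre: "(W, e) \<in> frames A \<Longrightarrow> p \<in> W \<Longrightarrow> i < vb_rank A \<Longrightarrow> e i p \<in> fibre A p"
  by (simp add: frame_span span_base)

lemma subspace_fibre: "p \<in> U \<Longrightarrow> subspace (fibre A p)"
  by (metis frame_around frame_span subspace_span)

lemma anchor_in_tangent_space: "p \<in> U \<Longrightarrow> a \<in> fibre A p \<Longrightarrow> anchor A p a \<in> tangent_space M p"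
  using lie_algebroid unfolding lie_algebroid_def bundle_map_to_tangent_def by blast

lemma anchor_add: "p \<in> U \<Longrightarrow> a \<in> fibre A p \<Longrightarrow> b \<in> fibre A p \<Longrightarrow> anchor A p (a + b) = anchor A p a + anchor A p b"
  and anchor_scale: "p \<in> U \<Longrightarrow> a \<in> fibre A p \<Longrightarrow> anchor A p (k *\<^sub>R a) = k *\<^sub>R anchor A p a"
  using lie_algebroid by (auto simp: lie_algebroid_def bundle_map_to_tangent_def)

lemma frame_anchor_smooth:
  "(W, e) \<in> frames A \<Longrightarrow> i < vb_rank A \<Longrightarrow> smooth_section M (tangent_bundle M) W (\<lambda>p. anchor A p (e i p))"
  using lie_algebroid by (fastforce simp: lie_algebroid_def bundle_map_to_tangent_def)

lemma leibniz:
  "s \<in> sections M U A \<Longrightarrow> t \<in> sections M U A \<Longrightarrow> smooth_fun M U f \<Longrightarrow>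
    bracket A s (\<lambda>p. f p *\<^sub>R t p) = (\<lambda>p. f p *\<^sub>R bracket A s t p) + (\<lambda>p. anchor A p (s p) f *\<^sub>R t p)"
  using lie_algebroid by (simp add: lie_algebroid_def plus_fun_def)

lemma section_in_fibre: "s \<in> sections M U A \<Longrightarrow> p \<in> U \<Longrightarrow> s p \<in> fibre A p"
  by (simp add: sections_def smooth_section_def)

lemma lie_sections: "lie_algebra (sections M U A) (bracket A)"
  using lie_algebroid by (simp add: lie_algebroid_def)

lemma section_scale:
  assumes s: "s \<in> sections M U A" and f: "smooth_fun M U f"
  shows "(\<lambda>p. f p *\<^sub>R s p) \<in> sections M U A"
  unfolding sections_def smooth_section_def
proof (intro CollectI conjI ballI allI impI)
  fix p assume "p \<in> U"
  then show "f p *\<^sub>R s p \<in> fibre A p" using section_in_fibre[OF s] subspace_fibre subspace_scale by blast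
next
  fix We assume We: "We \<in> frames A"
  obtain W e where [simp]: "We = (W, e)" by force
  obtain c where c: "\<forall>i<vb_rank A. smooth_fun M (W \<inter> U) (c i)"
      "\<forall>p\<in>W \<inter> U. s p = (\<Sum>i<vb_rank A. c i p *\<^sub>R e i p)"
    using s We by (fastforce simp: sections_def smooth_section_def)
  have o: "openin (topo M) (W \<inter> U)" using frame_domain[of W e] We open_base by auto
  have "smooth_fun M (W \<inter> U) (\<lambda>p. f p * c i p)" if "i < vb_rank A" for i
    using smooth_fun_mult[OF o smooth_fun_subset[OF f]] c(1) that by auto
  moreover have "f p *\<^sub>R s p = (\<Sum>i<vb_rank A. (f p * c i p) *\<^sub>R e i p)" if "p \<in> W \<inter> U" for p
    using c(2) that by (simp add: scaleR_sum_right)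
  ultimately show "case We of (W, e) \<Rightarrow> \<exists>c. (\<forall>i<vb_rank A. smooth_fun M (W \<inter> U) (c i)) \<and>
      (\<forall>p\<in>W \<inter> U. f p *\<^sub>R s p = (\<Sum>i<vb_rank A. c i p *\<^sub>R e i p))"
    by (auto intro!: exI[of _ "\<lambda>i p. f p * c i p"])
qed (use s in \<open>simp add: sections_def\<close>)

text \<open>The anchor preserves brackets: expand the Jacobi identity of \<open>s\<close>, \<open>t\<close>, \<open>f w\<close> by the
  Leibniz rule. What remains is \<open>(\<rho>(s)\<rho>(t)f - \<rho>(t)\<rho>(s)f - \<rho>([s, t])f) w = 0\<close>.\<close>

lemma anchor_bracket:
  assumes s: "s \<in> sections M U A" and t: "t \<in> sections M U A" and w: "w \<in> sections M U A"
    and f: "smooth_fun M U f" and sf: "smooth_fun M U (\<lambda>p. anchor A p (s p) f)"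
    and tf: "smooth_fun M U (\<lambda>p. anchor A p (t p) f)" and p: "w p \<noteq> 0"
  shows "anchor A p (bracket A s t p) f =
    anchor A p (s p) (\<lambda>q. anchor A q (t q) f) - anchor A p (t p) (\<lambda>q. anchor A q (s q) f)"
proof -
  let ?S = "sections M U A" and ?br = "bracket A"
  have br: "?br a b \<in> ?S" if "a \<in> ?S" "b \<in> ?S" for a b using lie_sections that by (simp add: lie_algebra_def)
  have sub: "subspace ?S" using lie_sections by (simp add: lie_algebra_def)
  have addl: "?br (a + b) c = ?br a c + ?br b c" and addr: "?br c (a + b) = ?br c a + ?br c b"
    if "a \<in> ?S" "b \<in> ?S" "c \<in> ?S" for a b c using lie_sections that by (simp_all add: lie_algebra_def)
  have alt: "?br a a = 0" if "a \<in> ?S" for a using lie_sections that by (simp add: lie_algebra_def)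
  have anti: "?br a b = - ?br b a" if a: "a \<in> ?S" and b: "b \<in> ?S" for a b
  proof -
    have ab: "a + b \<in> ?S" using a b subspace_add[OF sub] by blast
    have "0 = ?br (a + b) (a + b)" by (rule alt[OF ab, symmetric])
    also have "\<dots> = ?br a b + ?br b a"
      using addl[OF a b ab] addr[OF a b a] addr[OF a b b] alt[OF a] alt[OF b] by simp
    finally have "?br a b + ?br b a = 0" by simp
    then show ?thesis by (simp add: eq_neg_iff_add_eq_0)
  qed
  have jac: "?br a (?br b c) - ?br b (?br a c) - ?br (?br a b) c = 0"
    if a: "a \<in> ?S" and b: "b \<in> ?S" and c: "c \<in> ?S" for a b c
  proof -
    have "?br b (?br c a) = - ?br b (?br a c)"
    proof -
      have "?br c a + ?br a c = 0" using anti[OF c a] by simp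
      then have "?br b (?br c a) + ?br b (?br a c) = ?br b 0"
        using addr[OF br[OF c a] br[OF a c] b] by simp
      moreover have "?br b 0 = 0" using addr[of 0 0 b] b subspace_0[OF sub] by simp
      ultimately show ?thesis by (simp add: eq_neg_iff_add_eq_0)
    qed
    moreover have "?br c (?br a b) = - ?br (?br a b) c" by (rule anti[OF c br[OF a b]])
    moreover have "?br a (?br b c) + ?br b (?br c a) + ?br c (?br a b) = 0"
      using lie_sections a b c by (simp add: lie_algebra_def)
    ultimately show ?thesis by simp
  qed
  have fw: "(\<lambda>p. f p *\<^sub>R w p) \<in> ?S" by (rule section_scale[OF w f])
  have expand: "?br a (?br b (\<lambda>p. f p *\<^sub>R w p)) p =
      f p *\<^sub>R ?br a (?br b w) p + anchor A p (a p) f *\<^sub>R ?br b w p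
      + anchor A p (b p) f *\<^sub>R ?br a w p + anchor A p (a p) (\<lambda>q. anchor A q (b q) f) *\<^sub>R w p"
    if a: "a \<in> ?S" and b: "b \<in> ?S" and bf: "smooth_fun M U (\<lambda>p. anchor A p (b p) f)" for a b
    unfolding leibniz[OF b w f]
    by (subst addr[OF section_scale[OF br[OF b w] f] section_scale[OF w bf] a])
      (simp add: leibniz[OF a br[OF b w] f] leibniz[OF a w bf])
  have "(?br s (?br t (\<lambda>p. f p *\<^sub>R w p)) - ?br t (?br s (\<lambda>p. f p *\<^sub>R w p)) - ?br (?br s t) (\<lambda>p. f p *\<^sub>R w p)) p = 0"
    by (simp only: jac[OF s t fw] zero_fun_apply)
  moreover have "(?br s (?br t w) - ?br t (?br s w) - ?br (?br s t) w) p = 0"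
    by (simp only: jac[OF s t w] zero_fun_apply)
  then have "?br s (?br t w) p = ?br t (?br s w) p + ?br (?br s t) w p"
    by (simp add: algebra_simps)
  ultimately have "(anchor A p (s p) (\<lambda>q. anchor A q (t q) f) - anchor A p (t p) (\<lambda>q. anchor A q (s q) f)
      - anchor A p (?br s t p) f) *\<^sub>R w p = 0"
    by (simp add: expand[OF s t tf] expand[OF t s sf] leibniz[OF br[OF s t] w f] algebra_simps)
  with p show ?thesis by simp
qed

text \<open>Transition coefficients between frames are only defined on overlaps; multiplied with the cutoff
  function they extend smoothly by zero.\<close>

lemma cutoff_frame_section:
  assumes We: "(W, e) \<in> frames A" and k: "k < vb_rank A"
    and \<kappa>: "closedin (topo M) C" "C \<subseteq> W" "\<And>p. p \<notin> C \<Longrightarrow> \<kappa> p = 0"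
    and sm: "smooth_fun M (topspace (topo M)) \<kappa>"
  shows "(\<lambda>p. if p \<in> W then \<kappa> p *\<^sub>R e k p else 0) \<in> sections M U A"
  unfolding sections_def smooth_section_def
proof (intro CollectI conjI ballI allI impI)
  fix p assume p: "p \<in> U"
  show "(if p \<in> W then \<kappa> p *\<^sub>R e k p else 0) \<in> fibre A p"
    by (simp add: frame_in_fibre[OF We _ k] subspace_scale subspace_0 subspace_fibre[OF p])
next
  fix We' assume We': "We' \<in> frames A"
  obtain W' e' where [simp]: "We' = (W', e')" by force
  have o: "openin (topo M) (W' \<inter> U)" using frame_domain[of W' e'] We' open_base by auto
  have W: "openin (topo M) W" "W' \<inter> U \<inter> W = W' \<inter> W" using frame_domain[OF We] by auto
  obtain c where c: "\<And>i. i < vb_rank A \<Longrightarrow> smooth_fun M (W' \<inter> W) (c i)"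
      "\<And>p. p \<in> W' \<inter> W \<Longrightarrow> e k p = (\<Sum>i<vb_rank A. c i p *\<^sub>R e' i p)"
    using frame_smooth[OF We k] We' by (fastforce simp: smooth_section_def)
  have "smooth_fun M (W' \<inter> U) (\<lambda>p. if p \<in> W then \<kappa> p * c i p else 0)" if "i < vb_rank A" for i
    by (rule smooth_fun_extend_by_zero[OF o W(1) \<kappa>(1,2) _ sm]) (use c(1)[OF that] W(2) \<kappa>(3) in auto)
  then show "case We' of (W', e') \<Rightarrow> \<exists>c. (\<forall>i<vb_rank A. smooth_fun M (W' \<inter> U) (c i)) \<and>
      (\<forall>p\<in>W' \<inter> U. (if p \<in> W then \<kappa> p *\<^sub>R e k p else 0) = (\<Sum>i<vb_rank A. c i p *\<^sub>R e' i p))"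
    using c(2) by (auto intro!: exI[of _ "\<lambda>i p. if p \<in> W then \<kappa> p * c i p else 0"] simp: scaleR_sum_right)
qed (use frame_domain[OF We] in auto)

lemma frame_anchor_apply_smooth:
  assumes We: "(W, e) \<in> frames A" and k: "k < vb_rank A" and f: "smooth_fun M (points M) f"
  shows "smooth_fun M W (\<lambda>p. anchor A p (e k p) f)"
proof -
  have W: "openin (topo M) W" "W \<inter> points M = W" using frame_domain[OF We] base_points by auto
  show ?thesis
    using smooth_fun_section_apply[OF frame_anchor_smooth[OF We k] W(1) _ f] W(2)
    by (simp add: points_def)
qed

text \<open>Frame sections, cut off to global ones, satisfy \<open>anchor_bracket\<close>. Their bracket at \<open>x\<close> lies in the
  fibre, and the anchors of all elements of this fibre kill \<open>g\<close>; so the commutator of the anchored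
  fields kills \<open>g\<close> at \<open>x\<close>.\<close>

lemma frame_anchors_commute:
  assumes We: "(W, e) \<in> frames A" and x: "x \<in> W" and j: "j < vb_rank A" and k: "k < vb_rank A"
    and g: "smooth_fun M (points M) g" and ann: "\<And>a. a \<in> fibre A x \<Longrightarrow> anchor A x a g = 0"
  shows "anchor A x (e k x) (\<lambda>p. anchor A p (e j p) g) = anchor A x (e j x) (\<lambda>p. anchor A p (e k p) g)"
proof -
  have W: "openin (topo M) W" "W \<subseteq> U" using frame_domain[OF We] by auto
  have xU: "x \<in> U" using W x by auto
  obtain \<kappa> C N where \<kappa>: "closedin (topo M) C" "C \<subseteq> W" "\<And>p. p \<notin> C \<Longrightarrow> \<kappa> p = 0"
    and N: "openin (topo M) N" "x \<in> N" "N \<subseteq> C" "\<And>p. p \<in> N \<Longrightarrow> \<kappa> p = 1"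
    and sm: "smooth_fun M (topspace (topo M)) \<kappa>"
    by (rule smooth_fun_cutoff[OF W(1) x]) blast
  define s where "s i p = (if p \<in> W then \<kappa> p *\<^sub>R e i p else 0)" for i p
  have s: "s i \<in> sections M U A" if "i < vb_rank A" for i
    unfolding s_def by (rule cutoff_frame_section[OF We that \<kappa> sm])
  have gU: "smooth_fun M U g" by (rule smooth_fun_subset[OF g base_points])
  have sN: "s i p = e i p" if "p \<in> N" for i p using that N \<kappa>(2) by (auto simp: s_def)
  have sg: "smooth_fun M U (\<lambda>p. anchor A p (s i p) g)" if i: "i < vb_rank A" for i
  proof (rule smooth_fun_cong[OF open_base])
    show "smooth_fun M U (\<lambda>p. if p \<in> W then \<kappa> p * anchor A p (e i p) g else 0)"
      by (rule smooth_fun_extend_by_zero[OF open_base W(1) \<kappa>(1,2) _ sm])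
        (use \<kappa>(3) smooth_fun_subset[OF frame_anchor_apply_smooth[OF We i g]] in auto)
    fix p assume p: "p \<in> U"
    have "anchor A p 0 = 0" using anchor_scale[OF p subspace_0[OF subspace_fibre[OF p]], of 0] by simp
    then show "(if p \<in> W then \<kappa> p * anchor A p (e i p) g else 0) = anchor A p (s i p) g"
      by (simp add: s_def anchor_scale[OF p frame_in_fibre[OF We _ i]] scaleR_fun_apply)
  qed
  have nz: "s k x \<noteq> 0"
    using frame_basis[OF We x] k unfolding sN[OF N(2)] basis_family_def
    by (metis dependent_zero imageI lessThan_iff)
  have near: "anchor A x (e i x) (\<lambda>q. anchor A q (s l q) g) = anchor A x (e i x) (\<lambda>q. anchor A q (e l q) g)"
    if "i < vb_rank A" for i l
    by (rule tangent_cong[OF anchor_in_tangent_space[OF xU frame_in_fibre[OF We x that]] N(1,2)])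
      (simp add: sN)
  have "bracket A (s k) (s j) \<in> sections M U A"
    using lie_sections s[OF k] s[OF j] by (simp add: lie_algebra_def)
  then have "anchor A x (bracket A (s k) (s j) x) g = 0"
    by (intro ann section_in_fibre xU)
  \<comment> \<open>The Jacobi identity is tested on \<open>s k\<close> itself, which is nonzero at \<open>x\<close>.\<close>
  then show ?thesis
    using anchor_bracket[OF s[OF k] s[OF j] s[OF k] gU sg[OF k] sg[OF j] nz]
    by (simp add: sN[OF N(2)] near j k)
qed

end

lemma linear_form_zero_on_span:
  fixes V :: "'v::real_vector set"
  assumes "linear_form_on V \<alpha>" "subspace V" "span B = V" "\<And>b. b \<in> B \<Longrightarrow> \<alpha> b = 0" "a \<in> V"
  shows "\<alpha> a = 0"
proof -
  have "subspace {a \<in> V. \<alpha> a = 0}"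
  proof (rule subspaceI)
    have "\<alpha> (0 *\<^sub>R 0) = 0 * \<alpha> 0" using assms(1) subspace_0[OF assms(2)] unfolding linear_form_on_def by blast
    then show "0 \<in> {a \<in> V. \<alpha> a = 0}" using subspace_0[OF assms(2)] by simp
  qed (use assms(1,2) in \<open>auto simp: linear_form_on_def subspace_add subspace_scale\<close>)
  then have "span B \<subseteq> {a \<in> V. \<alpha> a = 0}"
    using assms(3,4) span_superset[of B] by (intro span_minimal) auto
  with assms(3,5) show ?thesis by auto
qed

context algebroid
begin

lemma linear_form_pullback:
  assumes p: "p \<in> U" and \<alpha>: "\<alpha> \<in> cotangent_space M p"
  shows "linear_form_on (fibre A p) (\<lambda>a. \<alpha> (anchor A p a))"
  using \<alpha> anchor_in_tangent_space[OF p]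
  by (auto simp: linear_form_on_def cotangent_space_def dual_space_def anchor_add[OF p] anchor_scale[OF p])

lemma pullback_in_dual_space:
  assumes p: "p \<in> U" and \<alpha>: "\<alpha> \<in> cotangent_space M p"
  shows "pullback_form (fibre A p) (anchor A p) \<alpha> \<in> dual_space (fibre A p)"
  using linear_form_pullback[OF assms] subspace_fibre[OF p]
  by (auto simp: dual_space_def pullback_form_def linear_form_on_def subspace_add subspace_scale)

lemma poisson_bracket_frame_expansion:
  assumes P: "bivector_field M U A P"
    and \<pi>: "\<And>p. p \<in> U \<Longrightarrow> wedge2_map (fibre A p) (tangent_space M p) (anchor A p) (P p) = \<pi> p"
    and We: "(W, e) \<in> frames A"
  obtains c where "\<And>i j. smooth_fun M W (c i j)"
    and "\<And>p f g. p \<in> W \<Longrightarrow> poisson_bracket M \<pi> f g p = (\<Sum>j<vb_rank A. \<Sum>i<j. c i j p *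
      (anchor A p (e i p) f * anchor A p (e j p) g - anchor A p (e j p) f * anchor A p (e i p) g))"
proof -
  have W: "W \<inter> U = W" using frame_domain[OF We] by auto
  obtain c where c: "\<And>i j. smooth_fun M W (c i j)"
    and Pc: "\<And>p. p \<in> W \<Longrightarrow> P p = (\<Sum>j<vb_rank A. \<Sum>i<j. c i j p *\<^sub>R wedge2 (fibre A p) (e i p) (e j p))"
    using P We unfolding bivector_field_def by (fastforce simp: W)
  show thesis
  proof (rule that[OF c])
    fix p f g assume p: "p \<in> W"
    then have pU: "p \<in> U" using W by auto
    have d: "differential M p f \<in> cotangent_space M p" for f
      using differential_in_cotangent_space base_points pU by blast
    have "pullback_form (fibre A p) (anchor A p) (differential M p f) (e i p) = anchor A p (e i p) f"
      if "i < vb_rank A" for i f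
      using frame_in_fibre[OF We p that] anchor_in_tangent_space[OF pU]
      by (simp add: pullback_form_def differential_apply)
    then show "poisson_bracket M \<pi> f g p = (\<Sum>j<vb_rank A. \<Sum>i<j. c i j p *
      (anchor A p (e i p) f * anchor A p (e j p) g - anchor A p (e j p) f * anchor A p (e i p) g))"
      using d pullback_in_dual_space[OF pU d]
      by (simp add: poisson_bracket_def \<pi>[OF pU, symmetric] wedge2_map_def Pc[OF p] sum_fun_apply
          scaleR_fun_apply wedge2_def cotangent_space_def)
  qed
qed

text \<open>The anchor is linear on the fibre only. A linear extension to the whole type makes the library
  results on spans, independence and images applicable.\<close>

lemma anchor_linear_extension:
  assumes "p \<in> U"
  obtains L where "linear L" "\<And>a. a \<in> fibre A p \<Longrightarrow> L a = anchor A p a"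
proof -
  obtain W e where We: "(W, e) \<in> frames A" "p \<in> W" by (rule frame_around[OF assms])
  let ?B = "(\<lambda>i. e i p) ` {..<vb_rank A}"
  have B: "independent ?B" "span ?B = fibre A p" using frame_basis[OF We] by (auto simp: basis_family_def)
  obtain L where L: "linear L" "\<And>b. b \<in> ?B \<Longrightarrow> L b = anchor A p b"
    using linear_independent_extend[OF B(1), of "anchor A p"] by blast
  have "subspace {a \<in> fibre A p. L a = anchor A p a}"
    using subspace_fibre[OF assms] anchor_scale[OF assms subspace_0[OF subspace_fibre[OF assms]], of 0]
    by (auto intro!: subspaceI simp: linear_0[OF L(1)] linear_add[OF L(1)] linear_cmul[OF L(1)]
        anchor_add[OF assms] anchor_scale[OF assms] subspace_0 subspace_add subspace_scale)
  then have "span ?B \<subseteq> {a \<in> fibre A p. L a = anchor A p a}"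
    using L(2) frame_in_fibre[OF We] by (intro span_minimal) auto
  then show thesis using that[OF L(1)] B(2) by blast
qed

text \<open>A dense subset of a nonempty open set is nonempty, so there is a fibre on which the anchor is
  injective, and all fibres have the same dimension.\<close>

lemma almost_injective_rank_le:
  assumes "almost_injective M U A" "U \<noteq> {}"
  shows "vb_rank A \<le> DIM('e)"
proof -
  obtain D where D: "D \<subseteq> U" "U \<subseteq> topo M closure_of D" "\<And>p. p \<in> D \<Longrightarrow> inj_on (anchor A p) (fibre A p)"
    using assms(1) by (auto simp: almost_injective_def)
  obtain y where "y \<in> U" using assms(2) by auto
  with D(2) have "y \<in> topo M closure_of D" by blast
  then have "\<exists>p. p \<in> D" using \<open>y \<in> U\<close> open_base unfolding in_closure_of by blast
  then obtain p where p: "p \<in> D" "p \<in> U" using D(1) by auto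
  obtain W e where We: "(W, e) \<in> frames A" "p \<in> W" by (rule frame_around[OF p(2)])
  obtain V \<phi> where c: "(V, \<phi>) \<in> atlas M" "p \<in> V" using chart_around p(2) base_points by blast
  obtain L where L: "linear L" "\<And>a. a \<in> fibre A p \<Longrightarrow> L a = anchor A p a"
    by (rule anchor_linear_extension[OF p(2)]) blast
  let ?B = "(\<lambda>i. e i p) ` {..<vb_rank A}" and ?\<theta> = "chart_vector M (V, \<phi>) p"
  have B: "independent ?B" "span ?B = fibre A p" "card ?B = vb_rank A"
    using frame_basis[OF We] by (auto simp: basis_family_def card_image)
  have inj: "inj_on L (span ?B)"
    using D(3)[OF p(1)] L(2) unfolding B(2) by (simp cong: inj_on_cong)
  have "L ` ?B \<subseteq> range ?\<theta>"
    using L(2) frame_in_fibre[OF We] anchor_in_tangent_space[OF p(2)] tangent_space_chart[OF c] by fastforce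
  also have "range ?\<theta> = span (?\<theta> ` Basis)"
    using linear_span_image[OF linear_chart_vector[OF c], of Basis] by simp
  finally have "card (L ` ?B) \<le> card (?\<theta> ` Basis)"
    using independent_span_bound[OF _ linear_independent_injective_image[OF L(1) B(1) inj]] by auto
  also have "\<dots> \<le> DIM('e)" by (rule card_image_le) auto
  also have "card (L ` ?B) = vb_rank A"
    using card_image[OF inj_on_subset[OF inj span_superset]] B(3) by simp
  finally show ?thesis .
qed

end

section \<open>Isotropy points of desingularized Poisson structures\<close>

locale desingularized_isotropy_point = algebroid M U A
  for M :: "('m, 'e::euclidean_space) smooth_manifold" and U
    and A :: "('m, 'v::real_vector) lie_algebroid" +
  fixes P :: "'m \<Rightarrow> 'v bivector" and \<pi> :: "'m tangent_bivector_field" and x :: 'm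
    and W :: "'m set" and e :: "nat \<Rightarrow> 'm \<Rightarrow> 'v"
  assumes P_bivector: "bivector_field M U A P"
    and \<pi>_bivector: "bivector_field M (points M) (tangent_bundle M) \<pi>"
    and P_to_\<pi>: "\<And>p. p \<in> U \<Longrightarrow> wedge2_map (fibre A p) (tangent_space M p) (anchor A p) (P p) = \<pi> p"
    and frame: "(W, e) \<in> frames A" and x_frame: "x \<in> W"
    and \<pi>_x: "\<pi> x = 0"
begin

abbreviation anchored :: "nat \<Rightarrow> 'm \<Rightarrow> ('m \<Rightarrow> real) \<Rightarrow> real"
  where "anchored i p \<equiv> anchor A p (e i p)"

definition anchor_annihilator :: "((('m \<Rightarrow> real) \<Rightarrow> real) \<Rightarrow> real) set"
  where "anchor_annihilator = {\<alpha> \<in> cotangent_space M x. \<forall>a\<in>fibre A x. \<alpha> (anchor A x a) = 0}"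

lemma W_open: "openin (topo M) W" and x_base: "x \<in> U" and x_point: "x \<in> points M"
  using frame_domain[OF frame] x_frame base_points by auto

lemma isotropy: "isotropy_point M \<pi> x"
  by (simp add: isotropy_point_def x_point \<pi>_x)

lemma anchored_tangent: "i < vb_rank A \<Longrightarrow> anchored i x \<in> tangent_space M x"
  by (rule anchor_in_tangent_space[OF x_base frame_in_fibre[OF frame x_frame]])

lemma anchored_smooth_at: "i < vb_rank A \<Longrightarrow> smooth_fun M (points M) f \<Longrightarrow> smooth_at M x (\<lambda>p. anchored i p f)"
  by (rule smooth_at_smooth_fun[OF W_open x_frame frame_anchor_apply_smooth[OF frame]])

lemma anchor_annihilator_apply:
  "differential M x f \<in> anchor_annihilator \<Longrightarrow> a \<in> fibre A x \<Longrightarrow> anchor A x a f = 0"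
  using anchor_in_tangent_space[OF x_base] by (auto simp: anchor_annihilator_def differential_apply)

lemma subspace_anchor_annihilator: "subspace anchor_annihilator"
  by (rule subspaceI)
    (auto simp: anchor_annihilator_def cotangent_space_def dual_space_def linear_form_on_def
      scaleR_fun_apply algebra_simps)

text \<open>If \<open>d\<^sub>xf\<close> and \<open>d\<^sub>xg\<close> vanish on the image of the anchor, then \<open>{f, g}\<close> is a sum of products of
  two functions that vanish at \<open>x\<close>.\<close>

lemma anchor_annihilator_abelian:
  assumes \<alpha>: "\<alpha> \<in> anchor_annihilator" and \<beta>: "\<beta> \<in> anchor_annihilator"
  shows "isotropy_bracket M \<pi> x \<alpha> \<beta> = 0"
proof -
  obtain f where f: "smooth_fun M (points M) f" "differential M x f = \<alpha>"
    using covector_is_differential[OF x_point] \<alpha> by (auto simp: anchor_annihilator_def)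
  obtain g where g: "smooth_fun M (points M) g" "differential M x g = \<beta>"
    using covector_is_differential[OF x_point] \<beta> by (auto simp: anchor_annihilator_def)
  obtain c where c: "\<And>i j. smooth_fun M W (c i j)"
    and exp: "\<And>p f g. p \<in> W \<Longrightarrow> poisson_bracket M \<pi> f g p =
      (\<Sum>j<vb_rank A. \<Sum>i<j. c i j p * (anchored i p f * anchored j p g - anchored j p f * anchored i p g))"
    using poisson_bracket_frame_expansion[OF P_bivector P_to_\<pi> frame] by blast
  have 0: "anchored i x f = 0" "anchored i x g = 0" if "i < vb_rank A" for i
    using anchor_annihilator_apply frame_in_fibre[OF frame x_frame that] f(2) g(2) \<alpha> \<beta> by auto
  have "v (poisson_bracket M \<pi> f g) = 0" if v: "v \<in> tangent_space M x" for v
    by (subst tangent_apply_bivector_expansion[OF v W_open x_frame exp])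
      (auto simp: 0 intro!: sum.neutral smooth_at_smooth_fun[OF W_open x_frame c] anchored_smooth_at f(1) g(1))
  then have "differential M x (poisson_bracket M \<pi> f g) = 0" by (auto simp: differential_def)
  then show ?thesis
    using isotropy_bracket_differential[OF \<pi>_bivector isotropy f(1) g(1)] f(2) g(2) by simp
qed

text \<open>The derivative of \<open>{f, g}\<close> along an anchored frame field \<open>\<rho>\<^sub>k\<close> is \<open>{f, \<rho>\<^sub>k g}(x)\<close>: the terms
  without a second derivative of \<open>g\<close> vanish, and in the others \<open>\<rho>\<^sub>k \<rho>\<^sub>j g\<close> may be replaced by
  \<open>\<rho>\<^sub>j \<rho>\<^sub>k g\<close>.\<close>

lemma anchor_annihilator_ideal:
  assumes lie: "lie_algebra (cotangent_space M x) (isotropy_bracket M \<pi> x)"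
  shows "lie_ideal (cotangent_space M x) (isotropy_bracket M \<pi> x) anchor_annihilator"
  unfolding lie_ideal_def
proof (intro conjI ballI subspace_anchor_annihilator)
  show "anchor_annihilator \<subseteq> cotangent_space M x" by (auto simp: anchor_annihilator_def)
  fix \<alpha> \<beta> assume \<alpha>: "\<alpha> \<in> cotangent_space M x" and \<beta>: "\<beta> \<in> anchor_annihilator"
  obtain f where f: "smooth_fun M (points M) f" "differential M x f = \<alpha>"
    using covector_is_differential[OF x_point \<alpha>] by blast
  obtain g where g: "smooth_fun M (points M) g" "differential M x g = \<beta>"
    using covector_is_differential[OF x_point] \<beta> by (auto simp: anchor_annihilator_def)
  obtain c where c: "\<And>i j. smooth_fun M W (c i j)"
    and exp: "\<And>p f g. p \<in> W \<Longrightarrow> poisson_bracket M \<pi> f g p =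
      (\<Sum>j<vb_rank A. \<Sum>i<j. c i j p * (anchored i p f * anchored j p g - anchored j p f * anchored i p g))"
    using poisson_bracket_frame_expansion[OF P_bivector P_to_\<pi> frame] by blast
  have ann: "anchor A x a g = 0" if "a \<in> fibre A x" for a
    using anchor_annihilator_apply that g(2) \<beta> by auto
  have g0: "anchored i x g = 0" if "i < vb_rank A" for i
    by (rule ann[OF frame_in_fibre[OF frame x_frame that]])
  let ?\<gamma> = "differential M x (poisson_bracket M \<pi> f g)"
  have \<gamma>: "isotropy_bracket M \<pi> x \<alpha> \<beta> = ?\<gamma>"
    using isotropy_bracket_differential[OF \<pi>_bivector isotropy f(1) g(1)] f(2) g(2) by simp
  have \<gamma>_cot: "?\<gamma> \<in> cotangent_space M x" by (rule differential_in_cotangent_space[OF x_point])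
  have frame_zero: "?\<gamma> (anchored k x) = 0" if k: "k < vb_rank A" for k
  proof -
    let ?h = "\<lambda>p. anchored k p g"
    have comm: "anchored k x (\<lambda>p. anchored j p g) = anchored j x ?h" if "j < vb_rank A" for j
      by (rule frame_anchors_commute[OF frame x_frame that k g(1) ann])
    have "?\<gamma> (anchored k x) = anchored k x (poisson_bracket M \<pi> f g)"
      by (rule differential_apply[OF anchored_tangent[OF k]])
    also have "\<dots> = (\<Sum>j<vb_rank A. \<Sum>i<j. c i j x * (anchored i x f * anchored j x ?h - anchored j x f * anchored i x ?h))"
      by (subst tangent_apply_bivector_expansion[OF anchored_tangent[OF k] W_open x_frame exp])
        (auto simp: g0 comm intro!: sum.cong smooth_at_smooth_fun[OF W_open x_frame c] anchored_smooth_at f(1) g(1))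
    also have "\<dots> = poisson_bracket M \<pi> f ?h x" by (rule exp[OF x_frame, symmetric])
    also have "\<dots> = 0" by (simp add: poisson_bracket_def \<pi>_x)
    finally show ?thesis .
  qed
  have "?\<gamma> (anchor A x a) = 0" if "a \<in> fibre A x" for a
    by (rule linear_form_zero_on_span[OF linear_form_pullback[OF x_base \<gamma>_cot] subspace_fibre[OF x_base]
          frame_span[OF frame x_frame, symmetric] _ that]) (auto simp: frame_zero)
  then show "isotropy_bracket M \<pi> x \<alpha> \<beta> \<in> anchor_annihilator"
    using \<gamma> \<gamma>_cot by (simp add: anchor_annihilator_def)
qed

text \<open>A nonzero covector that vanishes on the image of the anchor would be a nonzero element of
  the abelian ideal \<open>anchor_annihilator\<close>. If the image is proper, the linear coordinate orthogonal to it in a chart has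
  such a covector as its differential.\<close>

lemma semisimple_imp_anchor_surjective:
  assumes ss: "semisimple_lie_algebra (cotangent_space M x) (isotropy_bracket M \<pi> x)"
  shows "tangent_space M x = anchor A x ` fibre A x"
proof -
  have "derived_subalgebra (isotropy_bracket M \<pi> x) anchor_annihilator = span {0}"
  proof -
    have "{isotropy_bracket M \<pi> x \<alpha> \<beta> |\<alpha> \<beta>. \<alpha> \<in> anchor_annihilator \<and> \<beta> \<in> anchor_annihilator} = {0}"
      using anchor_annihilator_abelian subspace_0[OF subspace_anchor_annihilator] by force
    then show ?thesis by (simp only: derived_subalgebra_def)
  qed
  then have "lie_solvable (isotropy_bracket M \<pi> x) anchor_annihilator"
    unfolding lie_solvable_def by (intro exI[of _ 1]) simp
  then have I0: "anchor_annihilator = {0}"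
    using ss anchor_annihilator_ideal by (auto simp: semisimple_lie_algebra_def)
  obtain V \<phi> where c: "(V, \<phi>) \<in> atlas M" "x \<in> V" by (rule chart_around[OF x_point])
  let ?\<theta> = "chart_vector M (V, \<phi>) x"
  obtain L where L: "linear L" "\<And>a. a \<in> fibre A x \<Longrightarrow> L a = anchor A x a"
    by (rule anchor_linear_extension[OF x_base]) blast
  let ?S = "?\<theta> -` (L ` fibre A x)"
  have sub: "subspace ?S"
    by (intro linear_subspace_vimage linear_chart_vector[OF c] linear_subspace_image L(1) subspace_fibre x_base)
  have "?S = UNIV"
  proof (rule ccontr)
    assume "?S \<noteq> UNIV"
    then obtain u where u: "u \<noteq> 0" "\<And>w. w \<in> ?S \<Longrightarrow> u \<bullet> w = 0"
      using span_not_UNIV_orthogonal[of ?S] span_eq_iff sub by metis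
    let ?f = "\<lambda>q. u \<bullet> \<phi> q"
    have lin: "linear (\<lambda>y. u \<bullet> y)" by (rule bounded_linear.linear[OF bounded_linear_inner_right])
    have d: "differential M x ?f (?\<theta> w) = u \<bullet> w" for w
      using chart_vector_coordinate[OF c lin] differential_apply[OF chart_vector_in_tangent_space[OF c]] by simp
    have "differential M x ?f (anchor A x a) = 0" if a: "a \<in> fibre A x" for a
    proof -
      have "anchor A x a \<in> range ?\<theta>" using anchor_in_tangent_space[OF x_base a] tangent_space_chart[OF c] by simp
      then obtain w where w: "anchor A x a = ?\<theta> w" by blast
      then have "w \<in> ?S" using L(2) a by force
      then show ?thesis using d u(2) w by simp
    qed
    then have "differential M x ?f \<in> anchor_annihilator"
      using differential_in_cotangent_space[OF x_point] by (simp add: anchor_annihilator_def)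
    then have "differential M x ?f (?\<theta> u) = 0" unfolding I0 by simp
    with d u(1) show False by simp
  qed
  then have "tangent_space M x \<subseteq> anchor A x ` fibre A x"
    using L(2) unfolding tangent_space_chart[OF c] by force
  then show ?thesis using anchor_in_tangent_space[OF x_base] by auto
qed

text \<open>By dimension the anchor at \<open>x\<close> is bijective, so every covector of the fibre is the pullback of
  a differential. Hence \<open>P x\<close> takes the same values as \<open>\<pi> x = 0\<close>, its sharp map is constant, and a
  bijection onto a nonzero space cannot be constant.\<close>

lemma surjective_anchor_imp_degenerate:
  assumes surj: "tangent_space M x = anchor A x ` fibre A x" and rank: "vb_rank A \<le> DIM('e)"
  shows "\<not> nondegenerate (fibre A x) (P x)"
proof -
  obtain V \<phi> where c: "(V, \<phi>) \<in> atlas M" "x \<in> V" by (rule chart_around[OF x_point])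
  let ?\<theta> = "chart_vector M (V, \<phi>) x" and ?r = "vb_rank A" and ?V = "fibre A x"
  have lin\<theta>: "linear ?\<theta>" by (rule linear_chart_vector[OF c])
  have inj\<theta>: "inj ?\<theta>"
  proof (subst linear_injective_0[OF lin\<theta>], intro allI impI)
    fix w assume w: "?\<theta> w = 0"
    have "?\<theta> w (\<lambda>q. w \<bullet> \<phi> q) = w \<bullet> w"
      by (rule chart_vector_coordinate[OF c bounded_linear.linear[OF bounded_linear_inner_right]])
    then show "w = 0" unfolding w by simp
  qed
  obtain L where L: "linear L" "\<And>a. a \<in> ?V \<Longrightarrow> L a = anchor A x a"
    by (rule anchor_linear_extension[OF x_base]) blast
  have "\<exists>w. ?\<theta> w = anchored i x" if "i < ?r" for i
    using anchored_tangent[OF that] unfolding tangent_space_chart[OF c] by force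
  \<comment> \<open>The vectors \<open>w i\<close> represent the images of the frame vectors in the chart. They span the
    model space, and there are at most \<open>DIM('e)\<close> of them, so they are a basis.\<close>
  then obtain w where w: "\<And>i. i < ?r \<Longrightarrow> ?\<theta> (w i) = anchored i x" by metis
  let ?B = "w ` {..<?r}"
  have im: "?\<theta> ` ?B = L ` (\<lambda>i. e i x) ` {..<?r}"
    unfolding image_image using w L(2) frame_in_fibre[OF frame x_frame] by (intro image_cong) auto
  have "?\<theta> ` span ?B = span (?\<theta> ` ?B)" by (rule linear_span_image[OF lin\<theta>, symmetric])
  also have "\<dots> = L ` ?V"
    unfolding im linear_span_image[OF L(1)] frame_span[OF frame x_frame] ..
  also have "\<dots> = tangent_space M x" using L(2) surj by simp
  also have "\<dots> = ?\<theta> ` UNIV" by (rule tangent_space_chart[OF c])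
  finally have span: "span ?B = UNIV" using inj\<theta> by (simp only: inj_image_eq_iff)
  have card_le: "card ?B \<le> ?r" using card_image_le[of "{..<?r}" w] by simp
  then have ind: "independent ?B"
    using rank span by (intro card_le_dim_spanning[of _ UNIV]) auto
  have "card ?B = DIM('e)" using dim_span_eq_card_independent[OF ind] by (simp add: span)
  then have r: "?r = DIM('e)" "card ?B = card {..<?r}" using card_le rank by auto
  have injw: "inj_on w {..<?r}" by (rule eq_card_imp_inj_on) (use r in auto)
  have ext: "\<exists>f. pullback_form ?V (anchor A x) (differential M x f) = \<alpha>" if \<alpha>: "\<alpha> \<in> dual_space ?V" for \<alpha>
  proof -
    obtain g where g: "linear g" "\<And>i. i < ?r \<Longrightarrow> g (w i) = \<alpha> (e i x)"
      using linear_independent_extend[OF ind, of "\<lambda>u. \<alpha> (e (the_inv_into {..<?r} w u) x)"]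
      by (auto simp: the_inv_into_f_f[OF injw])
    define f where "f = (\<lambda>q. g (\<phi> q))"
    have d: "differential M x f \<in> cotangent_space M x" by (rule differential_in_cotangent_space[OF x_point])
    have "linear_form_on ?V (\<lambda>a. differential M x f (anchor A x a) - \<alpha> a)"
      using linear_form_pullback[OF x_base d] \<alpha> by (auto simp: linear_form_on_def dual_space_def algebra_simps)
    moreover have "differential M x f (anchored i x) - \<alpha> (e i x) = 0" if "i < ?r" for i
      using chart_vector_coordinate[OF c g(1), of "w i"] g(2)[OF that]
      by (simp add: differential_apply[OF anchored_tangent[OF that]] w[OF that] f_def)
    ultimately have "differential M x f (anchor A x a) - \<alpha> a = 0" if "a \<in> ?V" for a
      using linear_form_zero_on_span[OF _ subspace_fibre[OF x_base] frame_span[OF frame x_frame, symmetric] _ that]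
      by fastforce
    then have "pullback_form ?V (anchor A x) (differential M x f) = \<alpha>"
      using \<alpha> by (auto simp: pullback_form_def dual_space_def)
    then show ?thesis by blast
  qed
  have P0: "P x \<alpha> \<beta> = 0" if \<alpha>: "\<alpha> \<in> dual_space ?V" and \<beta>: "\<beta> \<in> dual_space ?V" for \<alpha> \<beta>
  proof -
    obtain f where "pullback_form ?V (anchor A x) (differential M x f) = \<alpha>"
      using ext[OF \<alpha>] by blast
    moreover obtain g where "pullback_form ?V (anchor A x) (differential M x g) = \<beta>"
      using ext[OF \<beta>] by blast
    moreover have "wedge2_map ?V (tangent_space M x) (anchor A x) (P x) (differential M x f) (differential M x g) = 0"
      by (simp add: P_to_\<pi>[OF x_base] \<pi>_x)
    ultimately show ?thesis
      using differential_in_cotangent_space[OF x_point] by (simp add: wedge2_map_def cotangent_space_def)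
  qed
  show ?thesis
  proof
    assume "nondegenerate ?V (P x)"
    then have im: "sharp ?V (P x) ` dual_space ?V = ?V" by (simp add: nondegenerate_def bij_betw_def)
    have "sharp ?V (P x) \<alpha> = (THE v. v \<in> ?V \<and> (\<forall>\<beta>\<in>dual_space ?V. \<beta> v = 0))" if "\<alpha> \<in> dual_space ?V" for \<alpha>
      using P0 that by (simp add: sharp_def)
    then have "\<exists>a. ?V \<subseteq> {a}" using im by (metis (no_types, lifting) imageE insertCI subsetI)
    moreover have "0 \<in> ?V" by (rule subspace_0[OF subspace_fibre[OF x_base]])
    moreover have "e 0 x \<in> ?V" "e 0 x \<noteq> 0"
    proof -
      have 0: "0 < ?r" using r(1) by simp
      show "e 0 x \<in> ?V" by (rule frame_in_fibre[OF frame x_frame 0])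
      show "e 0 x \<noteq> 0"
        using frame_basis[OF frame x_frame] 0 unfolding basis_family_def by (metis dependent_zero imageI lessThan_iff)
    qed
    ultimately show False by auto
  qed
qed

end

theorem corollary27:
  fixes M :: "('m, 'e::euclidean_space) smooth_manifold"
    and \<pi> :: "'m tangent_bivector_field"
    and x :: 'm
  assumes "poisson_manifold M \<pi>"
    and "isotropy_point M \<pi> x"
    and "semisimple_lie_algebra (cotangent_space M x) (isotropy_bracket M \<pi> x)"
  shows "\<not> locally_desingularizable_at TYPE('v::real_vector) M \<pi> x
    \<and> \<not> desingularizable TYPE('v) M \<pi>"
proof -
  have x: "x \<in> points M" "\<pi> x = 0" using assms(2) by (auto simp: isotropy_point_def)
  have M: "smooth_manifold M" "bivector_field M (points M) (tangent_bundle M) \<pi>"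
    using assms(1) by (auto simp: poisson_manifold_def)
  have local: "\<not> has_desingularization_over TYPE('v) M \<pi> U" if U: "x \<in> U" for U
  proof
    assume "has_desingularization_over TYPE('v) M \<pi> U"
    then obtain A :: "('m, 'v) lie_algebroid" and P where A: "lie_algebroid M U A"
      and P: "bivector_field M U A P" "\<And>p. p \<in> U \<Longrightarrow> nondegenerate (fibre A p) (P p)"
      and inj: "almost_injective M U A"
      and \<pi>: "\<And>p. p \<in> U \<Longrightarrow> wedge2_map (fibre A p) (tangent_space M p) (anchor A p) (P p) = \<pi> p"
      by (auto simp: has_desingularization_over_def symplectic_lie_algebroid_def)
    interpret algebroid M U A by unfold_locales (rule M(1), rule A)
    obtain W e where We: "(W, e) \<in> frames A" "x \<in> W" by (rule frame_around[OF U])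
    interpret desingularized_isotropy_point M U A P \<pi> x W e
      by unfold_locales (use P(1) M(2) \<pi> We x(2) in auto)
    show False
      using surjective_anchor_imp_degenerate[OF semisimple_imp_anchor_surjective[OF assms(3)]
          almost_injective_rank_le[OF inj]] P(2)[OF U] U by auto
  qed
  show ?thesis using local x(1) by (auto simp: locally_desingularizable_at_def desingularizable_def)
qed

end
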